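(* For the decorated hypercubic lattice model described in the context, for every $d\ge1$, every even $L\ge4$ and every real $\mu$, $$\Big(1+\tfrac{e^{-\mu}}{2}\Big)^{-1}\ \ge\ \frac{\langle\hat N_{\rm e}\rangle_\mu}{N_{\rm d}}\ \ge\ 3^{-d}\Big(1+\tfrac{e^{-\mu}}{2}\Big)^{-1},$$ where $N_{\rm d}=L^d$. Moreover, if $d\ge2$, there are positive finite constants $\mu_1,c_1$ depending only on $d$ (not on $L,t,\lambda,U,U'$) such that for all $\mu\ge\mu_1$, $$\frac{\langle\hat N_{\rm e}\rangle_\mu}{N_{\rm d}}\ \ge\ 1-c_1e^{-\mu}.$$
   Context: Let $d\ge1$ and let $L\ge4$ be an even integer. Let $V=(\mathbb Z/L\mathbb Z)^d$ be the $d$-dimensional $L\times\cdots\times L$ hypercubic lattice with periodic boundary conditions, and let $B$ be the set of nearest-neighbour bonds $\{v,w\}$ ($v,w\in V$ at (periodic) Euclidean distance $1$). For each bond $\{v,w\}\in B$ introduce a new site $m(v,w)$ (the midpoint of the bond); let $M$ be the set of these midpoints and $\Lambda=V\cup M$. With fermion operators $c_{x\sigma}$, $x\in\Lambda$, $\sigma\in\{\uparrow,\downarrow\}$, satisfying the canonical anticommutation relations on the fermionic Fock space, $n_{x\sigma}=c^\dagger_{x\sigma}c_{x\sigma}$ and $\hat N_{\rm e}=\sum_x(n_{x\uparrow}+n_{x\downarrow})$, the Hamiltonian is $H=H_{\rm hop}+H_{\rm int}$ with $$H_{\rm hop}=\sum_{\sigma}\sum_{\{v,w\}\in B}t\,(c^\dagger_{v\sigma}+c^\dagger_{w\sigma}+\lambda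 c^\dagger_{m(v,w)\sigma})(c_{v\sigma}+c_{w\sigma}+\lambda c_{m(v,w)\sigma}),$$ $$H_{\rm int}=U\sum_{u\in V}n_{u\uparrow}n_{u\downarrow}+U'\sum_{x\in M}n_{x\uparrow}n_{x\downarrow},$$ where $t>0$, $\lambda>0$, $U>0$, $U'>0$. ($H$ is positive semidefinite.) Let $P_0$ be the orthogonal projection (on the whole Fock space) onto the eigenspace of $H$ with eigenvalue $0$. For an operator $O$ and $\mu\in\mathbb R$ define the grand-canonical ground-state average $$\langle O\rangle_\mu=\frac{\mathrm{Tr}[O\,e^{\mu\hat N_{\rm e}}P_0]}{\mathrm{Tr}[e^{\mu\hat N_{\rm e}}P_0]}.$$ *)

theory Defs
  imports Complex_Main "HOL-Library.List_Lexorder"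
begin

definition lat_V :: "nat \<Rightarrow> nat \<Rightarrow> nat list set" where
  "lat_V d L = {v. length v = d \<and> (\<forall>i<d. v ! i < L)}"

definition shift :: "nat \<Rightarrow> nat list \<Rightarrow> nat \<Rightarrow> nat list" where
  "shift L v j = v[j := (v ! j + 1) mod L]"

definition lat_adj :: "nat \<Rightarrow> nat \<Rightarrow> nat list \<Rightarrow> nat list \<Rightarrow> bool" where
  "lat_adj d L v w \<longleftrightarrow> (\<exists>j<d. w = shift L v j \<or> v = shift L w j)"

definition lat_B :: "nat \<Rightarrow> nat \<Rightarrow> nat list set set" where
  "lat_B d L = {{v, w} | v w. v \<in> lat_V d L \<and> w \<in> lat_V d L \<and> lat_adj d L v w}"

text \<open>Sites of Lambda: vertices, and midpoints of bonds (indexed by the bond).\<close>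
datatype site = Vtx "nat list" | Mid "nat list set"

definition lat_Lambda :: "nat \<Rightarrow> nat \<Rightarrow> site set" where
  "lat_Lambda d L = Vtx ` lat_V d L \<union> Mid ` lat_B d L"

text \<open>Fermion modes: site and spin (True = up, False = down).\<close>
type_synonym mode = "site \<times> bool"

definition modes :: "nat \<Rightarrow> nat \<Rightarrow> mode set" where
  "modes d L = lat_Lambda d L \<times> UNIV"

text \<open>A fixed total ordering of modes used for the Jordan-Wigner signs.\<close>
fun site_key :: "site \<Rightarrow> nat list" where
  "site_key (Vtx v) = 0 # v"
| "site_key (Mid b) = 1 # concat (sorted_list_of_set b)"

definition mode_key :: "mode \<Rightarrow> nat list" where
  "mode_key m = (if snd m then 1 else 0) # site_key (fst m)"

definition mode_less :: "mode \<Rightarrow> mode \<Rightarrow> bool" where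
  "mode_less m m' \<longleftrightarrow> mode_key m < mode_key m'"

text \<open>Vectors: complex amplitudes on occupation configurations (finite sets of modes).\<close>
type_synonym fvec = "mode set \<Rightarrow> complex"
type_synonym fop = "fvec \<Rightarrow> fvec"

definition jw_sign :: "mode \<Rightarrow> mode set \<Rightarrow> complex" where
  "jw_sign m T = (-1) ^ card {m' \<in> T. mode_less m' m}"

definition cdag :: "mode \<Rightarrow> fop" where
  "cdag m \<psi> T = (if m \<in> T then jw_sign m T * \<psi> (T - {m}) else 0)"

definition ann :: "mode \<Rightarrow> fop" where
  "ann m \<psi> T = (if m \<notin> T then jw_sign m T * \<psi> (insert m T) else 0)"

definition numop :: "mode \<Rightarrow> fop" where
  "numop m = cdag m \<circ> ann m"

definition op_add :: "fop \<Rightarrow> fop \<Rightarrow> fop" where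
  "op_add A B \<psi> T = A \<psi> T + B \<psi> T"

definition op_scale :: "complex \<Rightarrow> fop \<Rightarrow> fop" where
  "op_scale a A \<psi> T = a * A \<psi> T"

definition op_sum :: "('i \<Rightarrow> fop) \<Rightarrow> 'i set \<Rightarrow> fop" where
  "op_sum f I \<psi> T = (\<Sum>i\<in>I. f i \<psi> T)"

definition ket :: "mode set \<Rightarrow> fvec" where
  "ket S = (\<lambda>T. if T = S then 1 else 0)"

definition N_e :: "nat \<Rightarrow> nat \<Rightarrow> fop" where
  "N_e d L = op_sum numop (modes d L)"

definition bond_ann :: "real \<Rightarrow> bool \<Rightarrow> nat list set \<Rightarrow> fop" where
  "bond_ann lam \<sigma> b = op_add (op_sum (\<lambda>x. ann (Vtx x, \<sigma>)) b) (op_scale (of_real lam) (ann (Mid b, \<sigma>)))"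

definition bond_cdag :: "real \<Rightarrow> bool \<Rightarrow> nat list set \<Rightarrow> fop" where
  "bond_cdag lam \<sigma> b = op_add (op_sum (\<lambda>x. cdag (Vtx x, \<sigma>)) b) (op_scale (of_real lam) (cdag (Mid b, \<sigma>)))"

definition H_hop :: "nat \<Rightarrow> nat \<Rightarrow> real \<Rightarrow> real \<Rightarrow> fop" where
  "H_hop d L t lam = op_sum (\<lambda>(\<sigma>, b). op_scale (of_real t) (bond_cdag lam \<sigma> b \<circ> bond_ann lam \<sigma> b))
                        (UNIV \<times> lat_B d L)"

definition H_int :: "nat \<Rightarrow> nat \<Rightarrow> real \<Rightarrow> real \<Rightarrow> fop" where
  "H_int d L U U' = op_add
     (op_sum (\<lambda>u. op_scale (of_real U) (numop (Vtx u, True) \<circ> numop (Vtx u, False))) (lat_V d L))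
     (op_sum (\<lambda>b. op_scale (of_real U') (numop (Mid b, True) \<circ> numop (Mid b, False))) (lat_B d L))"

definition Ham :: "nat \<Rightarrow> nat \<Rightarrow> real \<Rightarrow> real \<Rightarrow> real \<Rightarrow> real \<Rightarrow> fop" where
  "Ham d L t lam U U' = op_add (H_hop d L t lam) (H_int d L U U')"

definition fock :: "nat \<Rightarrow> nat \<Rightarrow> fvec set" where
  "fock d L = {\<psi>. \<forall>T. \<not> T \<subseteq> modes d L \<longrightarrow> \<psi> T = 0}"

definition finner :: "mode set \<Rightarrow> fvec \<Rightarrow> fvec \<Rightarrow> complex" where
  "finner M \<phi> \<psi> = (\<Sum>T\<in>Pow M. cnj (\<phi> T) * \<psi> T)"

definition ground_space :: "nat \<Rightarrow> nat \<Rightarrow> real \<Rightarrow> real \<Rightarrow> real \<Rightarrow> real \<Rightarrow> fvec set" where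
  "ground_space d L t lam U U' = {\<psi> \<in> fock d L. Ham d L t lam U U' \<psi> = (\<lambda>_. 0)}"

definition P0 :: "nat \<Rightarrow> nat \<Rightarrow> real \<Rightarrow> real \<Rightarrow> real \<Rightarrow> real \<Rightarrow> fop" where
  "P0 d L t lam U U' \<psi> = (THE \<phi>. \<phi> \<in> ground_space d L t lam U U' \<and>
      (\<forall>\<chi>\<in>ground_space d L t lam U U'. finner (modes d L) \<chi> (\<lambda>T. \<psi> T - \<phi> T) = 0))"

text \<open>exp(mu N_e), defined through the spectral decomposition of the diagonal operator N_e.\<close>
definition expN :: "real \<Rightarrow> fop" where
  "expN \<mu> \<psi> T = of_real (exp (\<mu> * real (card T))) * \<psi> T"

definition ftrace :: "mode set \<Rightarrow> fop \<Rightarrow> complex" where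
  "ftrace M A = (\<Sum>S\<in>Pow M. A (ket S) S)"

definition gc_avg :: "nat \<Rightarrow> nat \<Rightarrow> real \<Rightarrow> real \<Rightarrow> real \<Rightarrow> real \<Rightarrow> real \<Rightarrow> fop \<Rightarrow> complex" where
  "gc_avg d L t lam U U' \<mu> A =
     ftrace (modes d L) (A \<circ> expN \<mu> \<circ> P0 d L t lam U U') /
     ftrace (modes d L) (expN \<mu> \<circ> P0 d L t lam U U')"

end

theory Submission
  imports Defs "HOL-Library.FuncSet"
begin

text \<open>
  Since \<open>H\<close> is a sum of positive terms, a zero-energy state is annihilated by every bond operator and has
  no doubly occupied site. The bond conditions determine it from its amplitudes on configurations of the
  vertices alone; the absence of double occupancy at the midpoints says that, after a change of signs, these
  amplitudes do not change when the spins of two neighbouring occupied vertices are exchanged.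
  Hence the ground states over an occupied set \<open>X\<close> are indexed by the number of up spins in each cluster \<open>C\<close>
  of \<open>X\<close>, and \<open>Tr[f(N) P0]\<close> is the sum over \<open>X\<close> of \<open>f(|X|)\<close> times the product of the \<open>|C| + 1\<close>.

  Occupying one more site multiplies the weight of \<open>X\<close> by at most \<open>2 exp \<mu>\<close>, and by exactly this factor if
  its neighbours are empty; this gives the two bounds, with \<open>1 + 2 d \<le> 3 ^ d\<close>. For \<open>d \<ge> 2\<close>, an isoperimetric
  inequality on the torus shows that all clusters but the largest contribute at most \<open>c ^ k\<close>, with \<open>k\<close> the
  number of empty sites. The partition function is thus dominated by a Bernoulli one, and Jensen's inequality
  turns this into the bound on the mean of \<open>k\<close>.
\<close>

subsection \<open>Spin classes of a site set and mean occupation\<close>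

text \<open>The vectors built from the spin classes form a basis of the ground space, but states at
  neighbouring vertices share a midpoint and overlap, while \<open>P0\<close> is given only by a
  definite description of an orthogonal projection. The trace is therefore taken with dual
  coordinates: each class has a vector of sharp particle number and a functional that reads one
  vertex amplitude of the class, and the two families are biorthogonal. The diagonal sum then
  collapses to a count of classes, and no overlap is computed.

  The weight of an occupied set is kept as this count. The product over clusters enters only as an
  upper bound; the full lattice enters through the lower bound |V| + 1, which the total number of up
  spins provides.

  The factor 1 + 2 d comes from a union bound over the at most 2 d neighbours of a site. The final
  constant 3 ^ (2 d ^ 2) * e combines the isoperimetric exponent d, the coordination number 2 d, and
  the exponential moment used in Jensen's inequality.\<close>

definition conn :: "('a \<Rightarrow> 'a \<Rightarrow> bool) \<Rightarrow> 'a set \<Rightarrow> ('a \<times> 'a) set" where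
  "conn E X = {(v, w). v \<in> X \<and> w \<in> X \<and> E v w}\<^sup>*"

text \<open>The closure in \<open>conn\<close> is reflexive on the whole type, hence the renewed
  restriction to \<open>X\<close>.\<close>

definition cluster :: "('a \<Rightarrow> 'a \<Rightarrow> bool) \<Rightarrow> 'a set \<Rightarrow> 'a \<Rightarrow> 'a set" where
  "cluster E X v = {w \<in> X. (v, w) \<in> conn E X}"

text \<open>Encoding a class as a function on sites, with value 0 off \<open>X\<close>, makes
  equality of classes plain equality of functions and lets keys over different sets be compared
  pointwise.\<close>

definition upkey :: "('a \<Rightarrow> 'a \<Rightarrow> bool) \<Rightarrow> 'a set \<Rightarrow> 'a set \<Rightarrow> 'a \<Rightarrow> nat" where
  "upkey E X A v = (if v \<in> X then card (A \<inter> cluster E X v) else 0)"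

text \<open>Counting keys instead of multiplying \<open>card C + 1\<close> over clusters turns the
  insertion estimates into surjections between finite sets.\<close>

definition spin_mult :: "('a \<Rightarrow> 'a \<Rightarrow> bool) \<Rightarrow> 'a set \<Rightarrow> nat" where
  "spin_mult E X = card (upkey E X ` Pow X)"

definition swaps :: "('a \<Rightarrow> 'a \<Rightarrow> bool) \<Rightarrow> 'a set \<Rightarrow> ('a set \<times> 'a set) set" where
  "swaps E X = {(A, insert w (A - {v})) | A v w. A \<subseteq> X \<and> v \<in> A \<and> w \<in> X - A \<and> E v w}"

lemma swapsI:
  "A \<subseteq> X \<Longrightarrow> v \<in> A \<Longrightarrow> w \<in> X \<Longrightarrow> w \<notin> A \<Longrightarrow> E v w \<Longrightarrow> (A, insert w (A - {v})) \<in> swaps E X"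
  by (auto simp: swaps_def)

lemma conn_sym:
  assumes "symp E" "(v, w) \<in> conn E X" shows "(w, v) \<in> conn E X"
proof -
  have "sym {(v, w). v \<in> X \<and> w \<in> X \<and> E v w}"
    using assms(1) by (auto simp: sym_def symp_def)
  then show ?thesis using assms(2) unfolding conn_def by (meson sym_rtrancl symD)
qed

lemma conn_trans: "(u, v) \<in> conn E X \<Longrightarrow> (v, w) \<in> conn E X \<Longrightarrow> (u, w) \<in> conn E X"
  unfolding conn_def by (rule rtrancl_trans)

lemma conn_edge: "v \<in> X \<Longrightarrow> w \<in> X \<Longrightarrow> E v w \<Longrightarrow> (v, w) \<in> conn E X"
  unfolding conn_def by auto

lemma cluster_self: "v \<in> X \<Longrightarrow> v \<in> cluster E X v"
  by (auto simp: cluster_def conn_def)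

lemma cluster_subset: "cluster E X v \<subseteq> X"
  by (auto simp: cluster_def)

lemma cluster_eq:
  assumes "symp E" "u \<in> cluster E X v" shows "cluster E X u = cluster E X v"
  using assms by (auto simp: cluster_def intro: conn_trans conn_sym)

text \<open>The ends of an edge inside \<open>X\<close> lie in the same cluster, so a cluster
  contains both the site that loses the up spin and the site that gains it, or neither.\<close>

lemma upkey_swap:
  assumes "symp E" "finite X" "(A, A') \<in> swaps E X"
  shows "upkey E X A' = upkey E X A"
proof
  fix u
  obtain v w where vw: "A' = insert w (A - {v})" "A \<subseteq> X" "v \<in> A" "w \<in> X" "w \<notin> A" "E v w"
    using assms(3) by (auto simp: swaps_def)
  have fin: "finite A" using vw(2) assms(2) finite_subset by blast
  show "upkey E X A' u = upkey E X A u"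
  proof (cases "u \<in> X")
    case True
    let ?C = "cluster E X u"
    have vX: "v \<in> X" using vw by auto
    have "(v, w) \<in> conn E X" "(w, v) \<in> conn E X"
      using conn_edge[of v X w E] vX vw conn_sym[OF assms(1)] by auto
    then have iff: "v \<in> ?C \<longleftrightarrow> w \<in> ?C"
      using vX vw by (auto simp: cluster_def intro: conn_trans)
    have "card (A' \<inter> ?C) = card (A \<inter> ?C)"
    proof (cases "v \<in> ?C")
      case True
      then have e: "A' \<inter> ?C = insert w ((A \<inter> ?C) - {v})" using iff vw by auto
      have "card (A' \<inter> ?C) = Suc (card ((A \<inter> ?C) - {v}))"
        unfolding e using fin vw by (subst card_insert_disjoint) auto
      also have "\<dots> = card (A \<inter> ?C)"
        using True vw fin by (intro card.remove[symmetric]) auto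
      finally show ?thesis .
    next
      case False
      then have "A' \<inter> ?C = A \<inter> ?C" using iff vw by auto
      then show ?thesis by simp
    qed
    then show ?thesis by (simp add: upkey_def)
  qed (simp add: upkey_def)
qed

lemma upkey_swaps:
  assumes "(A, A') \<in> (swaps E X)\<^sup>*" "symp E" "finite X"
  shows "upkey E X A' = upkey E X A"
  using assms(1) by (induction rule: rtrancl_induct) (auto simp: upkey_swap[OF assms(2,3)])

text \<open>An up spin travels along a path of occupied sites: either it hops first and the
  rest of the path follows, or the next site is already up and the rest of the path is done first.\<close>

lemma swaps_move:
  assumes "(v, w) \<in> conn E X" "A \<subseteq> X" "v \<in> A" "w \<in> X" "w \<notin> A"
  shows "(A, insert w (A - {v})) \<in> (swaps E X)\<^sup>*"
  using assms unfolding conn_def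
proof (induction arbitrary: A rule: converse_rtrancl_induct)
  case base then show ?case by simp
next
  case (step v u)
  then have uX: "u \<in> X" "E v u" by auto
  show ?case
  proof (cases "u \<in> A")
    case False
    have s1: "(A, insert u (A - {v})) \<in> swaps E X" 
      by (rule swapsI) (use step.prems uX False in auto)
    show ?thesis
    proof (cases "u = w")
      case True then show ?thesis using s1 by auto
    next
      case neq: False
      have "(insert u (A - {v}), insert w (insert u (A - {v}) - {u})) \<in> (swaps E X)\<^sup>*"
        using step.IH[of "insert u (A - {v})"] step.prems uX neq by auto
      moreover have "insert w (insert u (A - {v}) - {u}) = insert w (A - {v})" using False by auto
      ultimately show ?thesis using s1 by (simp add: converse_rtrancl_into_rtrancl)
    qed
  next
    case True
    have s1: "(A, insert w (A - {u})) \<in> (swaps E X)\<^sup>*"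
      using step.IH[of A] step.prems True by auto
    show ?thesis
    proof (cases "u = v")
      case True then show ?thesis using s1 by auto
    next
      case neq: False
      have "(insert w (A - {u}), insert u (insert w (A - {u}) - {v})) \<in> swaps E X"
        by (rule swapsI) (use step.prems uX neq True in auto)
      moreover have "insert u (insert w (A - {u}) - {v}) = insert w (A - {v})"
        using True neq step.prems by auto
      ultimately show ?thesis using s1 by (simp add: rtrancl_into_rtrancl)
    qed
  qed
qed

text \<open>Induction on the number of up spins of \<open>A\<close> outside \<open>A'\<close>. If
  one of them sits at \<open>v\<close>, equal counts in the cluster of \<open>v\<close> force a site
  \<open>w\<close> of that cluster into \<open>A'\<close> but not into \<open>A\<close>; moving the
  spin from \<open>v\<close> to \<open>w\<close> keeps the key and lowers the measure. With
  \<open>upkey_swaps\<close>, keys become a complete invariant of the exchange classes.\<close>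

lemma upkey_eq_imp_swaps:
  assumes sy: "symp E" and fin: "finite X"
  shows "A \<subseteq> X \<Longrightarrow> A' \<subseteq> X \<Longrightarrow> upkey E X A = upkey E X A' \<Longrightarrow> (A, A') \<in> (swaps E X)\<^sup>*"
proof (induction "card (A - A')" arbitrary: A rule: less_induct)
  case less
  have finA: "finite A" "finite A'" using less.prems fin finite_subset by blast+
  have key: "card (A \<inter> cluster E X u) = card (A' \<inter> cluster E X u)" if "u \<in> X" for u
    using fun_cong[OF less.prems(3), of u] that by (simp add: upkey_def)
  show ?case
  proof (cases "A - A' = {}")
    case True
    have "A = A'"
    proof (rule ccontr)
      assume "A \<noteq> A'"
      then obtain v where v: "v \<in> A'" "v \<notin> A" using True by auto
      then have "A \<inter> cluster E X v \<subset> A' \<inter> cluster E X v"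
        using True less.prems cluster_self[of v X E] by auto
      then have "card (A \<inter> cluster E X v) < card (A' \<inter> cluster E X v)"
        using finA by (intro psubset_card_mono) auto
      then show False using key[of v] v less.prems by auto
    qed
    then show ?thesis by simp
  next
    case False
    then obtain v where v: "v \<in> A" "v \<notin> A'" by auto
    let ?C = "cluster E X v"
    have vX: "v \<in> X" using v less.prems by auto
    have "\<not> A' \<inter> ?C \<subseteq> A"
    proof
      assume "A' \<inter> ?C \<subseteq> A"
      then have "A' \<inter> ?C \<subset> A \<inter> ?C" using v cluster_self[OF vX, of E] by auto
      then have "card (A' \<inter> ?C) < card (A \<inter> ?C)" using finA by (intro psubset_card_mono) auto
      then show False using key[OF vX] by simp
    qed
    then obtain w where w: "w \<in> A'" "w \<in> ?C" "w \<notin> A" by auto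
    then have wc: "(v, w) \<in> conn E X" "w \<in> X" by (auto simp: cluster_def)
    let ?A = "insert w (A - {v})"
    have m: "(A, ?A) \<in> (swaps E X)\<^sup>*" using swaps_move wc less.prems v w by metis
    have "?A - A' \<subset> A - A'" using v w by auto
    then have "card (?A - A') < card (A - A')" using finA by (intro psubset_card_mono) auto
    moreover have "?A \<subseteq> X" using less.prems wc by auto
    moreover have "upkey E X ?A = upkey E X A'"
      using upkey_swaps[OF m sy fin] less.prems by simp
    ultimately have "(?A, A') \<in> (swaps E X)\<^sup>*" using less.hyps less.prems by blast
    then show ?thesis using m by (rule_tac rtrancl_trans)
  qed
qed

section \<open>Number of classes when a site is added\<close>

lemma swaps_mono:
  assumes "X \<subseteq> Y" "D \<inter> X = {}" "D \<subseteq> Y" "(A, A') \<in> (swaps E X)\<^sup>*"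
  shows "(A \<union> D, A' \<union> D) \<in> (swaps E Y)\<^sup>*"
  using assms(4)
proof (induction rule: rtrancl_induct)
  case (step B C)
  obtain v w where vw: "C = insert w (B - {v})" "B \<subseteq> X" "v \<in> B" "w \<in> X" "w \<notin> B" "E v w"
    using step(2) by (auto simp: swaps_def)
  have "(B \<union> D, insert w ((B \<union> D) - {v})) \<in> swaps E Y"
    by (rule swapsI) (use vw assms in auto)
  moreover have "insert w ((B \<union> D) - {v}) = C \<union> D" using vw assms by auto
  ultimately show ?case using step by (simp add: rtrancl_into_rtrancl)
qed simp

text \<open>Exchanges inside \<open>X\<close> remain exchanges when the spin at \<open>x\<close> is
  frozen, so the key over the larger set depends only on the key of \<open>A - {x}\<close> and on
  the spin at \<open>x\<close>.\<close>

lemma spin_mult_insert_le: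
  assumes sy: "symp E" and fin: "finite X" and x: "x \<notin> X"
  shows "spin_mult E (insert x X) \<le> 2 * spin_mult E X"
proof -
  let ?Y = "insert x X"
  define rep where "rep h = (SOME A. A \<subseteq> X \<and> upkey E X A = h)" for h
  have rep: "rep (upkey E X A) \<subseteq> X \<and> upkey E X (rep (upkey E X A)) = upkey E X A"
    if "A \<subseteq> X" for A
    unfolding rep_def by (rule someI[where x = A]) (use that in auto)
  define f where "f = (\<lambda>(h, s). upkey E ?Y (rep h \<union> (if s then {x} else {})))"
  have "upkey E ?Y ` Pow ?Y \<subseteq> f ` ((upkey E X ` Pow X) \<times> (UNIV :: bool set))"
  proof
    fix k assume "k \<in> upkey E ?Y ` Pow ?Y"
    then obtain A where A: "A \<subseteq> ?Y" "k = upkey E ?Y A" by auto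
    let ?A = "A - {x}" and ?D = "A \<inter> {x}"
    have AX: "?A \<subseteq> X" using A by auto
    have "(?A, rep (upkey E X ?A)) \<in> (swaps E X)\<^sup>*"
      using upkey_eq_imp_swaps[OF sy fin AX] rep[OF AX] by metis
    then have "(?A \<union> ?D, rep (upkey E X ?A) \<union> ?D) \<in> (swaps E ?Y)\<^sup>*"
      by (rule swaps_mono[rotated 3]) (use x in auto)
    moreover have "?A \<union> ?D = A" by auto
    ultimately have "(A, rep (upkey E X ?A) \<union> ?D) \<in> (swaps E ?Y)\<^sup>*" by simp
    then have "upkey E ?Y (rep (upkey E X ?A) \<union> ?D) = upkey E ?Y A"
      by (rule upkey_swaps) (use sy fin in auto)
    then have "k = upkey E ?Y (rep (upkey E X ?A) \<union> ?D)" using A by simp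
    moreover have "?D = (if x \<in> A then {x} else {})" by auto
    ultimately have "k = f (upkey E X ?A, x \<in> A)" unfolding f_def by simp
    then show "k \<in> f ` ((upkey E X ` Pow X) \<times> UNIV)" using AX by auto
  qed
  then have "card (upkey E ?Y ` Pow ?Y) \<le> card ((upkey E X ` Pow X) \<times> (UNIV :: bool set))"
    by (rule surj_card_le[rotated]) (use fin in auto)
  then show ?thesis by (simp add: spin_mult_def card_cartesian_product)
qed

lemma cluster_insert_isolated:
  assumes "\<forall>y\<in>X. \<not> E x y \<and> \<not> E y x" "x \<notin> X" "v \<in> X"
  shows "cluster E (insert x X) v = cluster E X v"
proof -
  have fwd: "(v, w) \<in> conn E X \<and> w \<in> X" if "(v, w) \<in> conn E (insert x X)" for w
    using that unfolding conn_def
  proof (induction rule: rtrancl_induct)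
    case base then show ?case using assms by auto
  next
    case (step y z)
    then have "y \<in> X" "z \<in> X" "E y z" using assms by auto
    then have "(y, z) \<in> {(v, w). v \<in> X \<and> w \<in> X \<and> E v w}" by simp
    then show ?case using step \<open>z \<in> X\<close> by (meson rtrancl_into_rtrancl)
  qed
  have bwd: "(v, w) \<in> conn E X \<Longrightarrow> (v, w) \<in> conn E (insert x X)" for w
    unfolding conn_def by (erule rtrancl_mono[THEN subsetD, rotated]) auto
  show ?thesis using fwd bwd by (auto simp: cluster_def)
qed

lemma cluster_isolated:
  assumes "\<forall>y\<in>X. \<not> E x y"
  shows "cluster E (insert x X) x = {x}"
proof -
  have "w = x" if "(x, w) \<in> conn E (insert x X)" for w
    using that unfolding conn_def
    by (induction rule: rtrancl_induct) (use assms in auto)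
  moreover have "(x, x) \<in> conn E (insert x X)" by (simp add: conn_def)
  ultimately show ?thesis unfolding cluster_def by blast
qed

text \<open>An isolated site forms a cluster of its own and leaves the other clusters unchanged, so
  the spin at \<open>x\<close> and the key over \<open>X\<close> can both be read off the key over
  the larger set.\<close>

lemma spin_mult_insert_isolated:
  assumes fin: "finite X" and x: "x \<notin> X"
    and iso: "\<forall>y\<in>X. \<not> E x y \<and> \<not> E y x"
  shows "2 * spin_mult E X \<le> spin_mult E (insert x X)"
proof -
  let ?Y = "insert x X"
  \<comment> \<open>Value 1 at \<open>x\<close> means that \<open>x\<close> is up; resetting it to 0
    restores the key over \<open>X\<close>, which vanishes at \<open>x\<close>.\<close>
  define f where "f = (\<lambda>k :: 'a \<Rightarrow> nat. (k(x := 0), k x = 1))"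
  have ext: "f (upkey E ?Y (A \<union> (if s then {x} else {}))) = (upkey E X A, s)" if "A \<subseteq> X" for A s
  proof -
    have "upkey E ?Y (A \<union> (if s then {x} else {})) v = upkey E X A v" if "v \<noteq> x" for v
    proof (cases "v \<in> X")
      case True
      then have c: "cluster E ?Y v = cluster E X v" using cluster_insert_isolated[of X E x v] iso x by auto
      have "(A \<union> (if s then {x} else {})) \<inter> cluster E X v = A \<inter> cluster E X v"
        using cluster_subset[of E X v] x by auto
      then show ?thesis using True c by (simp add: upkey_def)
    qed (use that in \<open>simp add: upkey_def\<close>)
    moreover have "upkey E X A x = 0" using x by (simp add: upkey_def)
    moreover have "upkey E ?Y (A \<union> (if s then {x} else {})) x = (if s then 1 else 0)"
      using cluster_isolated[of X E x] iso \<open>A \<subseteq> X\<close> x by (auto simp: upkey_def)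
    ultimately show ?thesis unfolding f_def by auto
  qed
  have "(upkey E X ` Pow X) \<times> (UNIV :: bool set) \<subseteq> f ` (upkey E ?Y ` Pow ?Y)"
  proof
    fix p assume "p \<in> (upkey E X ` Pow X) \<times> (UNIV :: bool set)"
    then obtain A s where "A \<subseteq> X" "p = (upkey E X A, s)" by auto
    then have "p = f (upkey E ?Y (A \<union> (if s then {x} else {})))" using ext by simp
    moreover have "A \<union> (if s then {x} else {}) \<in> Pow ?Y" using \<open>A \<subseteq> X\<close> by auto
    ultimately show "p \<in> f ` (upkey E ?Y ` Pow ?Y)" by blast
  qed
  then have "card ((upkey E X ` Pow X) \<times> (UNIV :: bool set)) \<le> card (upkey E ?Y ` Pow ?Y)"
    by (rule surj_card_le[rotated]) (use fin in auto)
  then show ?thesis by (simp add: spin_mult_def card_cartesian_product)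
qed

lemma spin_mult_pos: "finite X \<Longrightarrow> 0 < spin_mult E X"
  unfolding spin_mult_def by (subst card_gt_0_iff) auto

text \<open>Exchanges preserve the total number of up spins, which takes \<open>card X + 1\<close>
  values. Applied to the full lattice, this replaces a proof that the torus is connected.\<close>

lemma spin_mult_ge:
  assumes sy: "symp E" and fin: "finite X"
  shows "card X + 1 \<le> spin_mult E X"
proof -
  have inv: "card A = card A'" if "A \<subseteq> X" "A' \<subseteq> X" "upkey E X A = upkey E X A'" for A A'
  proof -
    have "(A, A') \<in> (swaps E X)\<^sup>*" using upkey_eq_imp_swaps[OF sy fin] that by blast
    then show ?thesis using that(1)
    proof (induction rule: rtrancl_induct)
      case (step B C)
      obtain v w where vw: "C = insert w (B - {v})" "B \<subseteq> X" "v \<in> B" "w \<in> X" "w \<notin> B"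
        using step(2) by (auto simp: swaps_def)
      have "finite B" using vw fin finite_subset by blast
      then have "card C = card B" using vw card_Suc_Diff1[of B v] by (simp del: card_Diff_singleton)
      then show ?case using step by simp
    qed simp
  qed
  define S where "S n = (SOME A. A \<subseteq> X \<and> card A = n)" for n
  have S: "S n \<subseteq> X \<and> card (S n) = n" if n: "n \<le> card X" for n
  proof -
    obtain A where "A \<subseteq> X" "card A = n" using obtain_subset_with_card_n[OF n] by metis
    then show ?thesis unfolding S_def
      by (rule_tac someI[of "\<lambda>A. A \<subseteq> X \<and> card A = n" A]) simp
  qed
  have "inj_on (\<lambda>n. upkey E X (S n)) {..card X}"
    using inv S by (intro inj_onI) (metis atMost_iff)
  moreover have "(\<lambda>n. upkey E X (S n)) ` {..card X} \<subseteq> upkey E X ` Pow X" using S by auto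
  ultimately have "card {..card X} \<le> card (upkey E X ` Pow X)"
    using fin by (intro card_inj_on_le) auto
  then show ?thesis by (simp add: spin_mult_def)
qed

text \<open>A key factors through the tuple of up-spin counts, one for each cluster, so it suffices
  to count such tuples.\<close>

lemma spin_mult_le_prod:
  assumes fin: "finite X"
  shows "spin_mult E X \<le> (\<Prod>C\<in>cluster E X ` X. card C + 1)"
proof -
  let ?K = "cluster E X ` X"
  define f where "f = (\<lambda>c v. if v \<in> X then (c (cluster E X v) :: nat) else 0)"
  have "upkey E X ` Pow X \<subseteq> f ` (\<Pi>\<^sub>E C\<in>?K. {..card C})"
  proof
    fix k assume "k \<in> upkey E X ` Pow X"
    then obtain A where A: "A \<subseteq> X" "k = upkey E X A" by auto
    have "k = f (\<lambda>C\<in>?K. card (A \<inter> C))" unfolding f_def A(2) upkey_def by auto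
    moreover have "(\<lambda>C\<in>?K. card (A \<inter> C)) \<in> (\<Pi>\<^sub>E C\<in>?K. {..card C})"
      using finite_subset[OF cluster_subset fin] by (auto intro!: card_mono)
    ultimately show "k \<in> f ` (\<Pi>\<^sub>E C\<in>?K. {..card C})" by blast
  qed
  then have "card (upkey E X ` Pow X) \<le> card (\<Pi>\<^sub>E C\<in>?K. {..card C})"
    by (rule surj_card_le[rotated]) (use fin in \<open>auto intro!: finite_PiE\<close>)
  also have "\<dots> = (\<Prod>C\<in>?K. card C + 1)" using fin by (subst card_PiE) auto
  finally show ?thesis by (simp add: spin_mult_def)
qed

section \<open>Mean occupation from insertion ratios\<close>

lemma sum_Pow_containing:
  assumes "finite V" "x \<in> V"
  shows "(\<Sum>X\<in>{X \<in> Pow V. x \<in> X \<and> P (X - {x})}. f X) = (\<Sum>X\<in>{X \<in> Pow V. x \<notin> X \<and> P X}. f (insert x X))"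
  by (rule sum.reindex_bij_witness[where i = "insert x" and j = "\<lambda>X. X - {x}"])
     (use assms in \<open>auto simp: insert_absorb\<close>)

lemma sum_card_weight:
  fixes W :: "'a set \<Rightarrow> real"
  assumes "finite V"
  shows "(\<Sum>X\<in>Pow V. real (card X) * W X) = (\<Sum>x\<in>V. \<Sum>X\<in>{X \<in> Pow V. x \<in> X}. W X)"
proof -
  have "(\<Sum>X\<in>Pow V. real (card X) * W X) = (\<Sum>X\<in>Pow V. \<Sum>x\<in>V. if x \<in> X then W X else 0)"
  proof (rule sum.cong)
    fix X assume "X \<in> Pow V"
    then have "V \<inter> X = X" by auto
    then show "real (card X) * W X = (\<Sum>x\<in>V. if x \<in> X then W X else 0)"
      using assms by (simp add: sum.inter_restrict[symmetric])
  qed simp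
  also have "\<dots> = (\<Sum>x\<in>V. \<Sum>X\<in>Pow V. if x \<in> X then W X else 0)" by (rule sum.swap)
  also have "\<dots> = (\<Sum>x\<in>V. \<Sum>X\<in>{X \<in> Pow V. x \<in> X}. W X)"
    using assms by (intro sum.cong[OF refl] sum.inter_filter[symmetric]) simp
  finally show ?thesis .
qed

lemma occupied_split:
  fixes W :: "'a set \<Rightarrow> real"
  assumes "finite V"
  shows "(\<Sum>X\<in>{X \<in> Pow V. P X}. W X)
    = (\<Sum>X\<in>{X \<in> Pow V. x \<in> X \<and> P X}. W X) + (\<Sum>X\<in>{X \<in> Pow V. x \<notin> X \<and> P X}. W X)"
  using assms by (subst sum.union_disjoint[symmetric]) (auto intro!: sum.cong)

text \<open>At a fixed site, occupied configurations are matched with empty ones by deleting the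
  site. The occupied weight is at most \<open>k\<close> times the empty weight, a local bound k / (1
  + k) on the occupation, and this is summed over the sites.\<close>

lemma mean_card_upper:
  fixes W :: "'a set \<Rightarrow> real"
  assumes fin: "finite V"
    and ins: "\<And>x X. x \<in> V \<Longrightarrow> X \<subseteq> V \<Longrightarrow> x \<notin> X \<Longrightarrow> W (insert x X) \<le> k * W X"
  shows "(1 + k) * (\<Sum>X\<in>Pow V. real (card X) * W X) \<le> k * real (card V) * (\<Sum>X\<in>Pow V. W X)"
proof -
  have "(1 + k) * (\<Sum>X\<in>{X \<in> Pow V. x \<in> X}. W X) \<le> k * (\<Sum>X\<in>Pow V. W X)" if "x \<in> V" for x
  proof -
    have "(\<Sum>X\<in>{X \<in> Pow V. x \<in> X}. W X) = (\<Sum>X\<in>{X \<in> Pow V. x \<notin> X}. W (insert x X))"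
      using sum_Pow_containing[OF fin that, where P = "\<lambda>_. True"] by simp
    also have "\<dots> \<le> (\<Sum>X\<in>{X \<in> Pow V. x \<notin> X}. k * W X)"
      by (rule sum_mono) (use ins that in auto)
    also have "\<dots> = k * (\<Sum>X\<in>{X \<in> Pow V. x \<notin> X}. W X)" by (simp add: sum_distrib_left)
    finally show ?thesis
      using occupied_split[OF fin, where P = "\<lambda>_. True" and W = W and x = x]
      by (simp add: Pow_def algebra_simps)
  qed
  then have "(\<Sum>x\<in>V. (1 + k) * (\<Sum>X\<in>{X \<in> Pow V. x \<in> X}. W X)) \<le> (\<Sum>x\<in>V. k * (\<Sum>X\<in>Pow V. W X))"
    by (rule sum_mono)
  then show ?thesis unfolding sum_card_weight[OF fin] sum_distrib_left[symmetric] by (simp add: mult_ac)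
qed

lemma sum_UN_le:
  fixes f :: "'b \<Rightarrow> real"
  assumes "finite I" "\<And>i. i \<in> I \<Longrightarrow> finite (A i)" "\<And>i x. i \<in> I \<Longrightarrow> x \<in> A i \<Longrightarrow> 0 \<le> f x"
  shows "(\<Sum>x\<in>(\<Union>i\<in>I. A i). f x) \<le> (\<Sum>i\<in>I. \<Sum>x\<in>A i. f x)"
  using assms
proof (induction I rule: finite_induct)
  case (insert j I)
  have "(\<Sum>x\<in>A j \<union> (\<Union>i\<in>I. A i). f x) \<le> (\<Sum>x\<in>A j. f x) + (\<Sum>x\<in>(\<Union>i\<in>I. A i). f x)"
    using insert by (subst sum.union_inter[symmetric]) (auto intro!: sum_nonneg)
  also have "\<dots> \<le> (\<Sum>x\<in>A j. f x) + (\<Sum>i\<in>I. \<Sum>x\<in>A i. f x)"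
    by (intro add_left_mono insert.IH) (use insert.prems in auto)
  finally show ?case using insert by simp
qed simp

text \<open>The insertion ratio is available only while \<open>nb x\<close> is empty. The weight
  lost by this restriction is at most the sum of the occupied weights of the neighbours; summed over
  \<open>x\<close> it is at most \<open>D\<close> times the very mean being estimated, and this
  feedback is the term \<open>k * real D\<close>.\<close>

lemma mean_card_lower:
  fixes W :: "'a set \<Rightarrow> real"
  assumes fin: "finite V" and k: "0 \<le> k" and W0: "\<And>X. X \<subseteq> V \<Longrightarrow> 0 \<le> W X"
    and nb: "\<And>x. x \<in> V \<Longrightarrow> nb x \<subseteq> V - {x}" and deg: "\<And>y. y \<in> V \<Longrightarrow> card {x \<in> V. y \<in> nb x} \<le> D"
    and ins: "\<And>x X. x \<in> V \<Longrightarrow> X \<subseteq> V \<Longrightarrow> x \<notin> X \<Longrightarrow> X \<inter> nb x = {} \<Longrightarrow> k * W X \<le> W (insert x X)"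
  shows "k * real (card V) * (\<Sum>X\<in>Pow V. W X) \<le> (1 + k + k * real D) * (\<Sum>X\<in>Pow V. real (card X) * W X)"
proof -
  define S where "S x = (\<Sum>X\<in>{X \<in> Pow V. x \<in> X}. W X)" for x
  define Z where "Z = (\<Sum>X\<in>Pow V. W X)"
  have S0: "0 \<le> S x" for x unfolding S_def by (rule sum_nonneg) (use W0 in auto)
  have key: "k * (Z - (\<Sum>y\<in>nb x. S y)) \<le> (1 + k) * S x" if x: "x \<in> V" for x
  proof -
    let ?P = "\<lambda>X. X \<inter> nb x = {}"
    let ?Q = "\<Sum>X\<in>{X \<in> Pow V. ?P X}. W X"
    let ?in = "\<Sum>X\<in>{X \<in> Pow V. x \<in> X \<and> ?P X}. W X"
    let ?out = "\<Sum>X\<in>{X \<in> Pow V. x \<notin> X \<and> ?P X}. W X"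
    have fnb: "finite (nb x)" using nb[OF x] fin finite_subset by blast
    \<comment> \<open>Since \<open>x\<close> is not in \<open>nb x\<close>, deleting
      \<open>x\<close> does not change the intersection with \<open>nb x\<close>.\<close>
    have eq: "{X \<in> Pow V. x \<in> X \<and> ?P X} = {X \<in> Pow V. x \<in> X \<and> ?P (X - {x})}" using nb[OF x] by auto
    have "k * ?out = (\<Sum>X\<in>{X \<in> Pow V. x \<notin> X \<and> ?P X}. k * W X)" by (simp add: sum_distrib_left)
    also have "\<dots> \<le> (\<Sum>X\<in>{X \<in> Pow V. x \<notin> X \<and> ?P X}. W (insert x X))"
      by (rule sum_mono) (use ins x in auto)
    also have "\<dots> = ?in" unfolding eq by (rule sum_Pow_containing[OF fin x, symmetric])
    finally have 1: "k * ?out \<le> ?in" .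
    have 2: "?Q = ?in + ?out" by (rule occupied_split[OF fin])
    have 3: "?in \<le> S x" unfolding S_def using fin by (intro sum_mono2) (use W0 in auto)
    have "Z = ?Q + (\<Sum>X\<in>{X \<in> Pow V. \<not> ?P X}. W X)"
      unfolding Z_def using fin by (subst sum.union_disjoint[symmetric]) (auto intro!: sum.cong)
    moreover have "(\<Sum>X\<in>{X \<in> Pow V. \<not> ?P X}. W X) \<le> (\<Sum>y\<in>nb x. S y)"
    proof -
      have "{X \<in> Pow V. \<not> ?P X} = (\<Union>y\<in>nb x. {X \<in> Pow V. y \<in> X})" by auto
      then have "(\<Sum>X\<in>{X \<in> Pow V. \<not> ?P X}. W X) = (\<Sum>X\<in>(\<Union>y\<in>nb x. {X \<in> Pow V. y \<in> X}). W X)" by simp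
      also have "\<dots> \<le> (\<Sum>y\<in>nb x. S y)" unfolding S_def
        using fin fnb by (intro sum_UN_le) (use W0 in auto)
      finally show ?thesis .
    qed
    ultimately have "Z - (\<Sum>y\<in>nb x. S y) \<le> ?Q" by simp
    then have "k * (Z - (\<Sum>y\<in>nb x. S y)) \<le> k * ?Q" using k by (rule mult_left_mono)
    also have "\<dots> \<le> (1 + k) * ?in" using 1 2 by (simp add: algebra_simps)
    also have "\<dots> \<le> (1 + k) * S x" using 3 k by (intro mult_left_mono) auto
    finally show ?thesis .
  qed
  \<comment> \<open>Double counting: each \<open>S y\<close> is charged once for every site that has
    \<open>y\<close> as a neighbour.\<close>
  have "(\<Sum>x\<in>V. \<Sum>y\<in>nb x. S y) = (\<Sum>x\<in>V. \<Sum>y\<in>V. if y \<in> nb x then S y else 0)"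
  proof (rule sum.cong)
    fix x assume "x \<in> V"
    then have "V \<inter> nb x = nb x" using nb by auto
    then show "(\<Sum>y\<in>nb x. S y) = (\<Sum>y\<in>V. if y \<in> nb x then S y else 0)"
      using fin by (simp add: sum.inter_restrict[symmetric])
  qed simp
  also have "\<dots> = (\<Sum>y\<in>V. \<Sum>x\<in>V. if y \<in> nb x then S y else 0)" by (rule sum.swap)
  also have "\<dots> = (\<Sum>y\<in>V. real (card {x \<in> V. y \<in> nb x}) * S y)"
    using fin by (intro sum.cong[OF refl]) (simp add: sum.inter_filter[symmetric])
  also have "\<dots> \<le> (\<Sum>y\<in>V. real D * S y)"
    by (intro sum_mono mult_right_mono) (use deg S0 in auto)
  finally have nbs: "(\<Sum>x\<in>V. \<Sum>y\<in>nb x. S y) \<le> real D * (\<Sum>y\<in>V. S y)" by (simp add: sum_distrib_left)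
  have "(\<Sum>x\<in>V. k * (Z - (\<Sum>y\<in>nb x. S y))) \<le> (\<Sum>x\<in>V. (1 + k) * S x)"
    by (rule sum_mono) (rule key)
  then have "k * (real (card V) * Z - (\<Sum>x\<in>V. \<Sum>y\<in>nb x. S y)) \<le> (1 + k) * (\<Sum>x\<in>V. S x)"
    by (simp add: sum_distrib_left[symmetric] sum_subtractf)
  moreover have "k * (\<Sum>x\<in>V. \<Sum>y\<in>nb x. S y) \<le> k * (real D * (\<Sum>y\<in>V. S y))"
    using nbs k by (rule mult_left_mono)
  ultimately have "k * real (card V) * Z \<le> (1 + k + k * real D) * (\<Sum>x\<in>V. S x)"
    by (simp add: algebra_simps)
  then show ?thesis unfolding sum_card_weight[OF fin] S_def Z_def .
qed

subsection \<open>The torus\<close>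

text \<open>Let E be the mean number of empty sites. Jensen bounds exp E by the mean of the
  exponential of that number. The numerator of this mean is at most a binomial sum, m V * (z + c e)
  ^ |V|, and the denominator is at least the fully occupied term m V * z ^ |V|. The quotient is at
  most exp (|V| c e / z), which bounds E.\<close>

lemma mean_complement_upper:
  fixes m :: "'a set \<Rightarrow> real"
  assumes fin: "finite V" and z: "0 < z" and c: "0 < c"
    and m0: "\<And>X. X \<subseteq> V \<Longrightarrow> 0 \<le> m X" and mV: "0 < m V"
    and le: "\<And>X. X \<subseteq> V \<Longrightarrow> m X \<le> m V * c ^ card (V - X)"
  shows "real (card V) * (1 - c * exp 1 / z) * (\<Sum>X\<in>Pow V. m X * z ^ card X)
    \<le> (\<Sum>X\<in>Pow V. real (card X) * (m X * z ^ card X))"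
proof -
  define w where "w X = m X * z ^ card X" for X
  define Z where "Z = (\<Sum>X\<in>Pow V. w X)"
  define a where "a X = real (card (V - X))" for X
  define E where "E = (\<Sum>X\<in>Pow V. a X * w X) / Z"
  have w0: "0 \<le> w X" if "X \<subseteq> V" for X using m0[OF that] z by (simp add: w_def)
  have ZV: "m V * z ^ card V \<le> Z" unfolding Z_def w_def
    by (rule member_le_sum[of V "Pow V" "\<lambda>X. m X * z ^ card X"]) (use fin w0 in \<open>auto simp: w_def\<close>)
  have Zp: "0 < Z" using ZV mV z by (meson mult_pos_pos zero_less_power less_le_trans)
  \<comment> \<open>Jensen's inequality in tangent form: exp (a X) is at least exp E * (1 + a X -
    E), and the linear part averages to zero because \<open>E\<close> is the weighted mean of
    \<open>a\<close>.\<close>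
  have "exp E * Z = (\<Sum>X\<in>Pow V. exp E * (1 + (a X - E)) * w X)"
  proof -
    have "(\<Sum>X\<in>Pow V. exp E * (1 + (a X - E)) * w X)
        = exp E * ((\<Sum>X\<in>Pow V. w X) + (\<Sum>X\<in>Pow V. a X * w X) - E * (\<Sum>X\<in>Pow V. w X))"
      by (simp add: sum_distrib_left sum.distrib sum_subtractf algebra_simps)
    also have "(\<Sum>X\<in>Pow V. a X * w X) = E * Z" using Zp by (simp add: E_def)
    finally show ?thesis by (simp add: Z_def)
  qed
  also have "\<dots> \<le> (\<Sum>X\<in>Pow V. exp (a X) * w X)"
  proof (rule sum_mono)
    fix X assume X: "X \<in> Pow V"
    have "exp E * (1 + (a X - E)) \<le> exp E * exp (a X - E)"
      by (intro mult_left_mono exp_ge_add_one_self) auto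
    also have "\<dots> = exp (a X)" by (simp add: exp_add[symmetric])
    finally show "exp E * (1 + (a X - E)) * w X \<le> exp (a X) * w X"
      using w0 X by (intro mult_right_mono) auto
  qed
  also have "\<dots> \<le> (\<Sum>X\<in>Pow V. m V * (z ^ card X * (c * exp 1) ^ card (V - X)))"
  proof (rule sum_mono)
    fix X assume X: "X \<in> Pow V"
    have e: "exp (a X) = exp 1 ^ card (V - X)" by (simp add: a_def exp_of_nat_mult[symmetric])
    have "exp (a X) * w X \<le> exp (a X) * ((m V * c ^ card (V - X)) * z ^ card X)"
      unfolding w_def using le X z by (intro mult_left_mono mult_right_mono) auto
    then show "exp (a X) * w X \<le> m V * (z ^ card X * (c * exp 1) ^ card (V - X))"
      by (simp add: e power_mult_distrib mult_ac)
  qed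
  also have "\<dots> = m V * (z + c * exp 1) ^ card V"
  proof -
    have "(\<Prod>i\<in>V. z + c * exp 1) = (\<Sum>X\<in>Pow V. (\<Prod>i\<in>X. z) * (\<Prod>i\<in>V - X. c * exp 1))"
      by (rule prod_add[OF fin])
    then show ?thesis by (simp add: sum_distrib_left)
  qed
  also have "\<dots> = m V * z ^ card V * (1 + c * exp 1 / z) ^ card V"
    using z by (simp add: power_mult_distrib[symmetric] field_simps)
  also have "\<dots> \<le> Z * (1 + c * exp 1 / z) ^ card V"
    using ZV z c by (intro mult_right_mono) auto
  also have "\<dots> \<le> Z * exp (c * exp 1 / z) ^ card V"
    using Zp z c by (intro mult_left_mono power_mono exp_ge_add_one_self) auto
  also have "\<dots> = Z * exp (real (card V) * (c * exp 1 / z))" by (subst exp_of_nat_mult) simp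
  finally have "exp E \<le> exp (real (card V) * (c * exp 1 / z))" using Zp by (simp add: mult.commute)
  then have "E \<le> real (card V) * (c * exp 1 / z)" by simp
  then have "E * Z \<le> real (card V) * (c * exp 1 / z) * Z" using Zp by (intro mult_right_mono) auto
  then have EZ: "(\<Sum>X\<in>Pow V. a X * w X) \<le> real (card V) * (c * exp 1 / z) * Z"
    using Zp by (simp add: E_def)
  have "(\<Sum>X\<in>Pow V. a X * w X) = (\<Sum>X\<in>Pow V. real (card V) * w X - real (card X) * w X)"
  proof (rule sum.cong)
    fix X assume "X \<in> Pow V"
    then have "finite X" "X \<subseteq> V" using fin finite_subset by auto
    then have "a X = real (card V) - real (card X)"
      using fin by (simp add: a_def card_Diff_subset of_nat_diff card_mono)
    then show "a X * w X = real (card V) * w X - real (card X) * w X" by (simp add: left_diff_distrib)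
  qed simp
  also have "\<dots> = real (card V) * Z - (\<Sum>X\<in>Pow V. real (card X) * w X)"
    by (simp add: sum_subtractf Z_def sum_distrib_left)
  finally have "real (card V) * Z - real (card V) * (c * exp 1 / z) * Z \<le> (\<Sum>X\<in>Pow V. real (card X) * w X)"
    using EZ by linarith
  then show ?thesis by (simp add: w_def Z_def algebra_simps)
qed

section \<open>Lattice points, shifts and neighbours\<close>

lemma lat_V_eq: "lat_V d L = {xs. set xs \<subseteq> {..<L} \<and> length xs = d}"
  by (auto simp: lat_V_def set_conv_nth)

lemma finite_lat_V [simp]: "finite (lat_V d L)"
  by (simp add: lat_V_eq finite_lists_length_eq)

lemma card_lat_V [simp]: "card (lat_V d L) = L ^ d"
  by (simp add: lat_V_eq card_lists_length_eq)

lemma lat_V_update: "v \<in> lat_V d L \<Longrightarrow> a < L \<Longrightarrow> v[i := a] \<in> lat_V d L"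
  by (cases "i < d") (auto simp: lat_V_def nth_list_update)

lemma shift_in_lat_V: "v \<in> lat_V d L \<Longrightarrow> 0 < L \<Longrightarrow> shift L v j \<in> lat_V d L"
  unfolding shift_def by (rule lat_V_update) auto

lemma symp_lat_adj: "symp (lat_adj d L)"
  by (auto simp: symp_def lat_adj_def)

lemma lat_adj_commute: "lat_adj d L v w = lat_adj d L w v"
  by (auto simp: lat_adj_def)

lemma shift_neq:
  assumes "v \<in> lat_V d L" "2 \<le> L" "j < d" shows "shift L v j \<noteq> v"
proof
  assume "shift L v j = v"
  moreover have "shift L v j ! j = (v ! j + 1) mod L" using assms by (simp add: shift_def lat_V_def)
  ultimately have e: "(v ! j + 1) mod L = v ! j" by simp
  have "v ! j < L" using assms by (simp add: lat_V_def)
  then show False using e assms by (cases "v ! j + 1 = L") auto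
qed

lemma lat_adj_neq: "v \<in> lat_V d L \<Longrightarrow> 2 \<le> L \<Longrightarrow> lat_adj d L v w \<Longrightarrow> v \<noteq> w"
  using shift_neq by (auto simp: lat_adj_def) metis+

lemma shift_inj:
  assumes "v \<in> lat_V d L" "w \<in> lat_V d L" "j < d" "shift L v j = shift L w j"
  shows "v = w"
proof (rule nth_equalityI)
  show l: "length v = length w" using assms by (simp add: lat_V_def)
  fix i assume i: "i < length v"
  show "v ! i = w ! i"
  proof (cases "i = j")
    case True
    have b: "v ! j < L" "w ! j < L" using assms by (auto simp: lat_V_def)
    have "shift L v j ! j = (v ! j + 1) mod L" "shift L w j ! j = (w ! j + 1) mod L"
      using assms(1-3) by (auto simp: shift_def lat_V_def)
    then have "(v ! j + 1) mod L = (w ! j + 1) mod L" using assms(4) by simp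
    then have "v ! j = w ! j" using b
      by (cases "v ! j + 1 = L"; cases "w ! j + 1 = L") auto
    then show ?thesis using True by simp
  next
    case False
    then have "shift L v j ! i = v ! i" "shift L w j ! i = w ! i" using i l by (auto simp: shift_def)
    then show ?thesis using assms(4) by simp
  qed
qed

text \<open>Each direction gives one forward neighbour and, by injectivity of the shift, at most one
  backward neighbour.\<close>

lemma card_lat_nbrs: "card {y \<in> lat_V d L. lat_adj d L x y} \<le> 2 * d"
proof -
  have "{y \<in> lat_V d L. lat_adj d L x y}
      \<subseteq> (shift L x ` {..<d}) \<union> (\<Union>j<d. {y \<in> lat_V d L. x = shift L y j})"
    by (auto simp: lat_adj_def)
  then have "card {y \<in> lat_V d L. lat_adj d L x y}
      \<le> card ((shift L x ` {..<d}) \<union> (\<Union>j<d. {y \<in> lat_V d L. x = shift L y j}))"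
    by (intro card_mono) auto
  also have "\<dots> \<le> card (shift L x ` {..<d}) + card (\<Union>j<d. {y \<in> lat_V d L. x = shift L y j})"
    by (rule card_Un_le)
  also have "\<dots> \<le> d + (\<Sum>j<d. card {y \<in> lat_V d L. x = shift L y j})"
    using card_image_le[of "{..<d}" "shift L x"] card_UN_le[of "{..<d}"] by (intro add_mono) auto
  also have "\<dots> \<le> d + (\<Sum>j<d. 1)"
  proof (intro add_left_mono sum_mono)
    fix j assume "j \<in> {..<d}"
    then have "finite {y \<in> lat_V d L. x = shift L y j}"
      "\<forall>u\<in>{y \<in> lat_V d L. x = shift L y j}. \<forall>w\<in>{y \<in> lat_V d L. x = shift L y j}. u = w"
      using shift_inj[of _ d L _ j] by auto
    then show "card {y \<in> lat_V d L. x = shift L y j} \<le> 1"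
      unfolding One_nat_def by (rule card_le_Suc0_iff_eq[THEN iffD2])
  qed
  finally show ?thesis by simp
qed

section \<open>Outer boundaries and isoperimetry\<close>

definition lat_bdry :: "nat \<Rightarrow> nat \<Rightarrow> nat list set \<Rightarrow> nat list set" where
  "lat_bdry d L C = {w \<in> lat_V d L - C. \<exists>v\<in>C. lat_adj d L v w}"

lemma finite_lat_bdry [simp]: "finite (lat_bdry d L C)"
  by (simp add: lat_bdry_def)

text \<open>If no boundary site had this coordinate \<open>j\<close>, then within the slice
  \<open>C\<close> would be closed under forward shifts in all other directions. On a torus forward
  shifts reach every value, so the coordinates of \<open>v\<close> can be replaced by those of
  \<open>w\<close> one at a time without leaving \<open>C\<close>.\<close>

lemma slice_meets_bdry:
  assumes C: "C \<subseteq> lat_V d L" and j: "j < d" and v: "v \<in> C" and w: "w \<in> lat_V d L" "w \<notin> C"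
    and vw: "v ! j = w ! j"
  shows "\<exists>u\<in>lat_bdry d L C. u ! j = v ! j"
proof (rule ccontr)
  assume no: "\<not> ?thesis"
  have L: "0 < L" using w j by (auto simp: lat_V_def)
  have step: "shift L u i \<in> C" if "u \<in> C" "u ! j = v ! j" "i < d" "i \<noteq> j" for u i
  proof (rule ccontr)
    assume "shift L u i \<notin> C"
    moreover have "shift L u i \<in> lat_V d L" using shift_in_lat_V that C L by auto
    moreover have "lat_adj d L u (shift L u i)" using that by (auto simp: lat_adj_def)
    ultimately have "shift L u i \<in> lat_bdry d L C" using that by (auto simp: lat_bdry_def)
    moreover have "shift L u i ! j = v ! j" using that by (simp add: shift_def)
    ultimately show False using no by blast
  qed
  have steps: "u[i := (u ! i + n) mod L] \<in> C" if u: "u \<in> C" "u ! j = v ! j" "i < d" "i \<noteq> j" for u i n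
  proof (induction n)
    case 0
    have "u ! i < L" using u C by (auto simp: lat_V_def)
    then show ?case using u by simp
  next
    case (Suc n)
    have "length u = d" using u C by (auto simp: lat_V_def)
    then have "shift L (u[i := (u ! i + n) mod L]) i = u[i := (u ! i + Suc n) mod L]"
      using u by (simp add: shift_def mod_Suc_eq)
    moreover have "u[i := (u ! i + n) mod L] ! j = v ! j" using u by simp
    ultimately show ?case using step[OF Suc _ u(3,4)] by metis
  qed
  have upd: "u[i := a] \<in> C" if u: "u \<in> C" "u ! j = v ! j" "i < d" "i \<noteq> j" "a < L" for u i a
  proof -
    have "u ! i < L" using u C by (auto simp: lat_V_def)
    \<comment> \<open>Going forward around the circle replaces backward steps; adding
      \<open>L\<close> keeps the subtraction of naturals exact.\<close>
    then have "(u ! i + (a + L - u ! i)) mod L = a" using u by simp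
    then show ?thesis using steps[OF u(1-4), of "a + L - u ! i"] by simp
  qed
  have len: "length v = d" "length w = d" using v w C by (auto simp: lat_V_def)
  \<comment> \<open>The hybrid agrees with \<open>w\<close> before position \<open>k\<close> and
    with \<open>v\<close> from there on; at position \<open>j\<close> nothing changes, because
    \<open>v\<close> and \<open>w\<close> agree there.\<close>
  have "take k w @ drop k v \<in> C \<and> (take k w @ drop k v) ! j = v ! j" if "k \<le> d" for k
    using that
  proof (induction k)
    case 0 then show ?case using v by simp
  next
    case (Suc k)
    let ?u = "take k w @ drop k v"
    have k: "k < d" using Suc by simp
    have e: "take (Suc k) w @ drop (Suc k) v = ?u[k := w ! k]"
      using k len by (simp add: take_Suc_conv_app_nth list_update_append Cons_nth_drop_Suc[symmetric])
    have lu: "length ?u = d" using len k by simp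
    have wk: "w ! k < L" using w k by (auto simp: lat_V_def)
    show ?case
    proof (cases "k = j")
      case True
      then have "?u[k := w ! k] = ?u" using Suc k vw by (metis Suc_leD list_update_id)
      then show ?thesis using e Suc by simp
    next
      case False
      then show ?thesis using e upd[of ?u k "w ! k"] Suc k wk by (simp add: nth_list_update)
    qed
  qed
  from this[of d] have "w \<in> C" using len by simp
  then show False using w by simp
qed

lemma card_slice_le:
  assumes "i < d"
  shows "card {v \<in> lat_V d L. v ! i = s} \<le> L ^ (d - 1)"
proof -
  let ?f = "\<lambda>v. take i v @ drop (Suc i) v"
  have "inj_on ?f {v \<in> lat_V d L. v ! i = s}"
  proof (rule inj_onI)
    fix v w assume v: "v \<in> {v \<in> lat_V d L. v ! i = s}" and w: "w \<in> {v \<in> lat_V d L. v ! i = s}"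
      and e: "?f v = ?f w"
    have l: "length v = d" "length w = d" using v w by (auto simp: lat_V_def)
    have "take i v = take i w \<and> drop (Suc i) v = drop (Suc i) w"
      using e l assms by (subst (asm) append_eq_append_conv) auto
    then show "v = w" using v w l assms by (metis (mono_tags, lifting) id_take_nth_drop mem_Collect_eq)
  qed
  moreover have "?f ` {v \<in> lat_V d L. v ! i = s} \<subseteq> lat_V (d - 1) L"
    using assms by (auto simp: lat_V_eq dest!: in_set_takeD in_set_dropD)
  ultimately have "card {v \<in> lat_V d L. v ! i = s} \<le> card (lat_V (d - 1) L)"
    by (intro card_inj_on_le[where f = ?f]) auto
  then show ?thesis by simp
qed

text \<open>A slice meeting both \<open>C\<close> and its complement contains a boundary site, so in
  each direction there are at most as many mixed slices as boundary sites. If some projection of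
  \<open>C\<close> is onto, every slice in that direction that meets the complement is mixed; these
  slices cover at least half of the torus, which bounds \<open>L\<close> itself and produces the
  factor 2. Otherwise no slice lies inside \<open>C\<close>, every slice meeting \<open>C\<close> is
  mixed, and \<open>C\<close> injects into a box whose sides are at most the boundary size.\<close>

lemma torus_isoperimetry:
  assumes C: "C \<subseteq> lat_V d L" and half: "2 * card C \<le> L ^ d" and d: "2 \<le> d"
  shows "card C \<le> (2 * card (lat_bdry d L C)) ^ d"
proof -
  let ?k = "card (lat_bdry d L C)"
  let ?pr = "\<lambda>j S. (\<lambda>v :: nat list. v ! j) ` S"
  have finC: "finite C" using C by (rule finite_subset) simp
  have mixed: "card (?pr j C \<inter> ?pr j (lat_V d L - C)) \<le> ?k" if "j < d" for j
  proof -
    have "?pr j C \<inter> ?pr j (lat_V d L - C) \<subseteq> ?pr j (lat_bdry d L C)"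
    proof
      fix s assume "s \<in> ?pr j C \<inter> ?pr j (lat_V d L - C)"
      then obtain v w where "v \<in> C" "w \<in> lat_V d L" "w \<notin> C" "s = v ! j" "v ! j = w ! j" by auto
      then show "s \<in> ?pr j (lat_bdry d L C)" using slice_meets_bdry[OF C that, of v w] by (metis image_eqI)
    qed
    then have "card (?pr j C \<inter> ?pr j (lat_V d L - C)) \<le> card (?pr j (lat_bdry d L C))"
      by (intro card_mono) auto
    also have "\<dots> \<le> ?k" by (intro card_image_le) auto
    finally show ?thesis .
  qed
  have sub: "?pr i S \<subseteq> {..<L}" if "i < d" "S \<subseteq> lat_V d L" for i S
    using that by (auto simp: lat_V_def)
  show ?thesis
  proof (cases "\<exists>i<d. ?pr i C = {..<L}")
    case True
    then obtain i where i: "i < d" "?pr i C = {..<L}" by auto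
    let ?P = "?pr i (lat_V d L - C)"
    have "L ^ d \<le> 2 * card (lat_V d L - C)"
      using C half finC by (simp add: card_Diff_subset)
    also have "lat_V d L - C \<subseteq> (\<Union>s\<in>?P. {v \<in> lat_V d L. v ! i = s})" by auto
    then have "card (lat_V d L - C) \<le> card (\<Union>s\<in>?P. {v \<in> lat_V d L. v ! i = s})"
      by (intro card_mono) auto
    also have "\<dots> \<le> (\<Sum>s\<in>?P. card {v \<in> lat_V d L. v ! i = s})" by (intro card_UN_le) auto
    also have "\<dots> \<le> (\<Sum>s\<in>?P. L ^ (d - 1))" by (intro sum_mono card_slice_le i)
    finally have "L ^ d \<le> 2 * card ?P * L ^ (d - 1)" by simp
    moreover have "L ^ d = L * L ^ (d - 1)" using d by (simp add: power_eq_if)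
    ultimately have "L * L ^ (d - 1) \<le> 2 * card ?P * L ^ (d - 1)" by simp
    then have "L \<le> 2 * card ?P" by (cases "L = 0") auto
    moreover have "?pr i C \<inter> ?P = ?P" using i(2) sub[OF i(1), of "lat_V d L - C"] by auto
    then have "card ?P \<le> ?k" using mixed[OF i(1)] by simp
    ultimately have "L \<le> 2 * ?k" by simp
    then have "L ^ d \<le> (2 * ?k) ^ d" by (intro power_mono) auto
    then show ?thesis using half by linarith
  next
    case False
    have pk: "card (?pr j C) \<le> ?k" if j: "j < d" for j
    proof -
      have "?pr j C \<subseteq> ?pr j (lat_V d L - C)"
      proof (rule ccontr)
        assume "\<not> ?pr j C \<subseteq> ?pr j (lat_V d L - C)"
        then obtain v where v: "v \<in> C" "v ! j \<notin> ?pr j (lat_V d L - C)" by auto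
        \<comment> \<open>A slice inside \<open>C\<close> projects onto all values in any other
          direction, contrary to the case assumption; a second direction exists because
          \<open>2 \<le> d\<close>.\<close>
        define i :: nat where "i = (if j = 0 then 1 else 0)"
        have i: "i < d" "i \<noteq> j" using d by (auto simp: i_def)
        have vV: "v \<in> lat_V d L" using v C by auto
        have "a \<in> ?pr i C" if "a < L" for a
        proof -
          have m: "v[i := a] \<in> lat_V d L" using lat_V_update[OF vV that] .
          moreover have "v[i := a] ! j = v ! j" using i by simp
          ultimately have "v[i := a] \<in> C" using v(2) by (metis DiffI image_eqI)
          moreover have "v[i := a] ! i = a" using vV i by (simp add: lat_V_def)
          ultimately show ?thesis by (metis image_eqI)
        qed
        then have "?pr i C = {..<L}" using sub[OF i(1) C] by auto
        then show False using False i by blast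
      qed
      then have "?pr j C \<inter> ?pr j (lat_V d L - C) = ?pr j C" by auto
      then show ?thesis using mixed[OF j] by simp
    qed
    have "card C \<le> card (\<Pi>\<^sub>E j\<in>{..<d}. ?pr j C)"
    proof (rule card_inj_on_le[where f = "\<lambda>v. \<lambda>j\<in>{..<d}. v ! j"])
      show "inj_on (\<lambda>v. \<lambda>j\<in>{..<d}. v ! j) C"
      proof (rule inj_onI)
        fix v w assume vw: "v \<in> C" "w \<in> C" "(\<lambda>j\<in>{..<d}. v ! j) = (\<lambda>j\<in>{..<d}. w ! j)"
        then have "length v = d" "length w = d" using C by (auto simp: lat_V_def)
        then show "v = w" using fun_cong[OF vw(3)] by (intro nth_equalityI) (auto simp: restrict_def split: if_splits, metis)
      qed
    qed (use finC in \<open>auto intro!: finite_PiE split: if_splits\<close>)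
    also have "\<dots> = (\<Prod>j<d. card (?pr j C))" by (simp add: card_PiE)
    also have "\<dots> \<le> (\<Prod>j<d. ?k)" by (intro prod_mono) (use pk in auto)
    also have "\<dots> \<le> (2 * ?k) ^ d" by (simp add: power_mono)
    finally show ?thesis .
  qed
qed

section \<open>From isoperimetry to a bound on the number of classes\<close>

lemma power_plus_one_le:
  fixes a n :: nat
  assumes "0 < n" shows "a ^ n + 1 \<le> (a + 1) ^ n"
  using assms
proof (induction n)
  case (Suc n)
  have "a ^ Suc n + 1 \<le> a * (a + 1) ^ n + 1 * (a + 1) ^ n"
    unfolding power_Suc by (intro add_mono mult_left_mono power_mono) auto
  then show ?case by (simp add: algebra_simps)
qed simp

text \<open>The polynomial bound is weakened to an exponential in the boundary size, so that a
  product over clusters becomes a sum of boundary sizes; the base comes from 2 k + 1 \<le> 3 ^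
  k.\<close>

lemma torus_isoperimetry_exp:
  assumes "C \<subseteq> lat_V d L" "2 * card C \<le> L ^ d" "2 \<le> d"
  shows "card C + 1 \<le> 3 ^ (d * card (lat_bdry d L C))"
proof -
  let ?k = "card (lat_bdry d L C)"
  have "card C + 1 \<le> (2 * ?k) ^ d + 1" using torus_isoperimetry[OF assms] by simp
  also have "\<dots> \<le> (2 * ?k + 1) ^ d" using assms(3) by (intro power_plus_one_le) simp
  also have "2 * k + 1 \<le> 3 ^ k" for k :: nat by (induction k) auto
  then have "(2 * ?k + 1) ^ d \<le> (3 ^ ?k) ^ d" by (intro power_mono) auto
  finally show ?thesis by (simp add: power_mult[symmetric] mult.commute)
qed

text \<open>Two disjoint clusters cannot both hold more than half of the sites, so at most one
  factor is bounded merely by \<open>L ^ d + 1\<close>. Every other cluster pays with its outer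
  boundary. Boundaries consist of empty sites, and an empty site borders at most 2 d clusters, so
  the boundary sizes add up to at most 2 d times the number of empty sites.\<close>

lemma spin_mult_exp_bound:
  assumes X: "X \<subseteq> lat_V d L" and d: "2 \<le> d"
  shows "spin_mult (lat_adj d L) X \<le> (L ^ d + 1) * 3 ^ (d * (2 * d * card (lat_V d L - X)))"
proof -
  let ?E = "lat_adj d L" and ?V = "lat_V d L"
  let ?cl = "cluster ?E X"
  let ?K = "?cl ` X"
  let ?B = "{C \<in> ?K. L ^ d < 2 * card C}" and ?S = "{C \<in> ?K. 2 * card C \<le> L ^ d}"
  have finX: "finite X" using X by (rule finite_subset) simp
  have finK: "finite ?K" using finX by simp
  have sub: "C \<subseteq> ?V" "finite C" if "C \<in> ?K" for C
    using that X finX cluster_subset[of ?E X] finite_subset by blast+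
  have dis: "C = D" if "C \<in> ?K" "D \<in> ?K" "u \<in> C" "u \<in> D" for C D u
    using that cluster_eq[OF symp_lat_adj] by (metis imageE)
  have "?K = ?B \<union> ?S" by auto
  then have "(\<Prod>C\<in>?K. card C + 1) = (\<Prod>C\<in>?B \<union> ?S. card C + 1)" by simp
  also have "\<dots> = (\<Prod>C\<in>?B. card C + 1) * (\<Prod>C\<in>?S. card C + 1)"
    using finK by (intro prod.union_disjoint) auto
  finally have split: "(\<Prod>C\<in>?K. card C + 1) = (\<Prod>C\<in>?B. card C + 1) * (\<Prod>C\<in>?S. card C + 1)" .
  have big: "(\<Prod>C\<in>?B. card C + 1) \<le> L ^ d + 1"
  proof (cases "?B = {}")
    case False
    then obtain C where CB: "C \<in> ?B" by blast
    have "D = C" if "D \<in> ?B" for D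
    proof (rule ccontr)
      assume "D \<noteq> C"
      then have "C \<inter> D = {}" using dis CB that by blast
      then have "card (C \<union> D) = card C + card D" using sub CB that by (intro card_Un_disjoint) auto
      moreover have "card (C \<union> D) \<le> card ?V" using sub CB that by (intro card_mono) auto
      ultimately show False using CB that by simp
    qed
    then have "?B = {C}" using CB by blast
    moreover have "card C \<le> card ?V" using sub CB by (intro card_mono) auto
    ultimately show ?thesis by simp
  qed (simp only: prod.empty)
  have "(\<Prod>C\<in>?S. card C + 1) \<le> (\<Prod>C\<in>?S. 3 ^ (d * card (lat_bdry d L C)))"
    by (intro prod_mono) (use torus_isoperimetry_exp sub d in auto)
  also have "\<dots> = 3 ^ (\<Sum>C\<in>?S. d * card (lat_bdry d L C))" by (rule power_sum[symmetric])
  also have "\<dots> \<le> 3 ^ (d * (2 * d * card (?V - X)))"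
  proof (rule power_increasing)
    \<comment> \<open>A boundary site in \<open>X\<close> would be joined to the cluster by an edge
      and hence belong to it.\<close>
    have bsub: "lat_bdry d L C \<subseteq> ?V - X" if "C \<in> ?K" for C
    proof
      fix w assume "w \<in> lat_bdry d L C"
      then obtain v where v: "w \<in> ?V" "w \<notin> C" "v \<in> C" "?E v w" by (auto simp: lat_bdry_def)
      have "w \<notin> X"
      proof
        assume wX: "w \<in> X"
        obtain u where u: "C = ?cl u" using \<open>C \<in> ?K\<close> by auto
        have vX: "v \<in> X" "(u, v) \<in> conn ?E X" using v u by (auto simp: cluster_def)
        then have "w \<in> C" using u wX conn_trans conn_edge[of v X w ?E] v(4) unfolding cluster_def by fast
        then show False using v by simp
      qed
      then show "w \<in> ?V - X" using v by simp
    qed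
    have "(\<Sum>C\<in>?S. card (lat_bdry d L C)) \<le> (\<Sum>C\<in>?K. card (lat_bdry d L C))"
      using finK by (intro sum_mono2) auto
    also have "\<dots> = (\<Sum>C\<in>?K. \<Sum>w\<in>?V - X. if w \<in> lat_bdry d L C then 1 else 0)"
    proof (rule sum.cong)
      fix C assume "C \<in> ?K"
      then have "(?V - X) \<inter> lat_bdry d L C = lat_bdry d L C" using bsub by auto
      then show "card (lat_bdry d L C) = (\<Sum>w\<in>?V - X. if w \<in> lat_bdry d L C then 1 else 0)"
        by (simp add: sum.inter_restrict[symmetric])
    qed simp
    also have "\<dots> = (\<Sum>w\<in>?V - X. \<Sum>C\<in>?K. if w \<in> lat_bdry d L C then 1 else 0)" by (rule sum.swap)
    also have "\<dots> = (\<Sum>w\<in>?V - X. card {C \<in> ?K. w \<in> lat_bdry d L C})"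
      using finK by (intro sum.cong[OF refl]) (simp add: sum.inter_filter[symmetric])
    also have "\<dots> \<le> (\<Sum>w\<in>?V - X. 2 * d)"
    proof (rule sum_mono)
      fix w assume "w \<in> ?V - X"
      \<comment> \<open>A cluster bordering \<open>w\<close> is the cluster of one of the neighbours
        of \<open>w\<close>.\<close>
      have "{C \<in> ?K. w \<in> lat_bdry d L C} \<subseteq> ?cl ` {y \<in> ?V. ?E w y}"
      proof
        fix C assume "C \<in> {C \<in> ?K. w \<in> lat_bdry d L C}"
        then obtain v where v: "v \<in> C" "?E v w" and CK: "C \<in> ?K" by (auto simp: lat_bdry_def)
        have "C = ?cl v" using CK v cluster_eq[OF symp_lat_adj] by (metis imageE)
        moreover have "v \<in> ?V" using sub CK v by auto
        ultimately show "C \<in> ?cl ` {y \<in> ?V. ?E w y}" using v lat_adj_commute by blast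
      qed
      then have "card {C \<in> ?K. w \<in> lat_bdry d L C} \<le> card (?cl ` {y \<in> ?V. ?E w y})"
        by (intro card_mono) auto
      also have "\<dots> \<le> card {y \<in> ?V. ?E w y}" by (intro card_image_le) auto
      also have "\<dots> \<le> 2 * d" by (rule card_lat_nbrs)
      finally show "card {C \<in> ?K. w \<in> lat_bdry d L C} \<le> 2 * d" .
    qed
    finally have "(\<Sum>C\<in>?S. card (lat_bdry d L C)) \<le> 2 * d * card (?V - X)" by (simp add: mult.commute)
    then show "(\<Sum>C\<in>?S. d * card (lat_bdry d L C)) \<le> d * (2 * d * card (?V - X))"
      by (simp add: sum_distrib_left[symmetric])
  qed simp
  finally have "(\<Prod>C\<in>?K. card C + 1) \<le> (L ^ d + 1) * 3 ^ (d * (2 * d * card (?V - X)))"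
    unfolding split by (intro mult_mono big) auto
  then show ?thesis using spin_mult_le_prod[OF finX, of ?E] by linarith
qed

subsection \<open>Zero-energy states on Fock space\<close>

lemma finite_lat_B [simp]: "finite (lat_B d L)"
  by (rule finite_subset[of _ "Pow (lat_V d L)"]) (auto simp: lat_B_def)

lemma finite_modes [simp]: "finite (modes d L)"
  by (simp add: modes_def lat_Lambda_def)

lemma lat_B_subset: "b \<in> lat_B d L \<Longrightarrow> b \<subseteq> lat_V d L"
  by (auto simp: lat_B_def)

lemma lat_B_card:
  assumes "b \<in> lat_B d L" "2 \<le> L"
  shows "card b = 2"
proof -
  obtain v w where "b = {v, w}" "v \<in> lat_V d L" "lat_adj d L v w" using assms by (auto simp: lat_B_def)
  then show ?thesis using lat_adj_neq[of v d L w] assms by auto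
qed

lemma Vtx_mode: "v \<in> lat_V d L \<Longrightarrow> (Vtx v, s) \<in> modes d L"
  by (auto simp: modes_def lat_Lambda_def)

lemma Mid_mode: "b \<in> lat_B d L \<Longrightarrow> (Mid b, s) \<in> modes d L"
  by (auto simp: modes_def lat_Lambda_def)

lemma bond_vtx_mode: "b \<in> lat_B d L \<Longrightarrow> x \<in> b \<Longrightarrow> (Vtx x, s) \<in> modes d L"
  using lat_B_subset Vtx_mode by blast

text \<open>Concatenation forgets where one vertex ends and the next begins. It is still injective
  on bonds, because all vertices have length \<open>d\<close> and every bond has two of
  them.\<close>

lemma site_key_Mid_inj:
  assumes b: "b \<in> lat_B d L" "b' \<in> lat_B d L" and L: "2 \<le> L"
    and e: "concat (sorted_list_of_set b) = concat (sorted_list_of_set b')"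
  shows "b = b'"
proof -
  have fin: "finite b" "finite b'" using b lat_B_subset finite_lat_V finite_subset by metis+
  have len: "length x = d" if "x \<in> set (sorted_list_of_set c)" "c \<in> lat_B d L" "finite c" for x c
    using that lat_B_subset by (auto simp: lat_V_def)
  have "length (sorted_list_of_set b) = length (sorted_list_of_set b')"
    using b L fin by (simp add: lat_B_card)
  moreover have "\<forall>(x, y)\<in>set (zip (sorted_list_of_set b) (sorted_list_of_set b')). length x = length y"
  proof (clarify)
    fix x y assume "(x, y) \<in> set (zip (sorted_list_of_set b) (sorted_list_of_set b'))"
    then have "x \<in> set (sorted_list_of_set b)" "y \<in> set (sorted_list_of_set b')"
      by (auto dest: set_zip_leftD set_zip_rightD simp del: set_sorted_list_of_set)
    then show "length x = length y" using len b fin by metis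
  qed
  ultimately have "sorted_list_of_set b = sorted_list_of_set b'"
    using e concat_eq_concat_iff by blast
  then show ?thesis using fin sorted_list_of_set_inject by blast
qed

lemma mode_key_inj:
  assumes "m \<in> modes d L" "m' \<in> modes d L" "2 \<le> L" "mode_key m = mode_key m'"
  shows "m = m'"
proof -
  obtain s \<sigma> s' \<sigma>' where m: "m = (s, \<sigma>)" "m' = (s', \<sigma>')" by fastforce
  have \<sigma>: "\<sigma> = \<sigma>'" and k: "site_key s = site_key s'"
    using assms(4) by (auto simp: m mode_key_def split: if_splits)
  have "s \<in> lat_Lambda d L" "s' \<in> lat_Lambda d L" using assms by (auto simp: m modes_def)
  then have "s = s'" using k assms(3)
    by (elim UnE imageE lat_Lambda_def[THEN equalityD1, THEN subsetD, elim_format])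
       (auto dest: site_key_Mid_inj)
  then show ?thesis using \<sigma> m by simp
qed

text \<open>Anticommutation of two different modes needs exactly one of the two orders to hold; this
  is what injectivity of \<open>mode_key\<close> on lattice modes is for.\<close>

lemma mode_less_total:
  "m \<in> modes d L \<Longrightarrow> m' \<in> modes d L \<Longrightarrow> 2 \<le> L \<Longrightarrow> m \<noteq> m' \<Longrightarrow> mode_less m m' \<longleftrightarrow> \<not> mode_less m' m"
  unfolding mode_less_def using mode_key_inj[of m d L m'] by (metis less_asym linorder_cases)

section \<open>Jordan-Wigner signs and anticommutation\<close>

lemma jw_sign_insert:
  assumes "finite T" "m \<notin> T"
  shows "jw_sign m' (insert m T) = (if mode_less m m' then - jw_sign m' T else jw_sign m' T)"
proof (cases "mode_less m m'")
  case True
  then have "{x \<in> insert m T. mode_less x m'} = insert m {x \<in> T. mode_less x m'}" by auto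
  then show ?thesis using True assms by (simp add: jw_sign_def)
next
  case False
  then have "{x \<in> insert m T. mode_less x m'} = {x \<in> T. mode_less x m'}" by auto
  then show ?thesis using False by (simp add: jw_sign_def)
qed

lemma mode_less_irrefl [simp]: "\<not> mode_less m m"
  by (simp add: mode_less_def)

lemma jw_sign_insert_self [simp]: "jw_sign m (insert m T) = jw_sign m T"
proof -
  have "{x \<in> insert m T. mode_less x m} = {x \<in> T. mode_less x m}" by auto
  then show ?thesis by (simp add: jw_sign_def)
qed

lemma jw_sign_remove_self [simp]: "jw_sign m (T - {m}) = jw_sign m T"
proof -
  have "{x \<in> T - {m}. mode_less x m} = {x \<in> T. mode_less x m}" by auto
  then show ?thesis by (simp add: jw_sign_def)
qed

lemma jw_sign_square [simp]: "jw_sign m T * jw_sign m T = 1"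
  by (simp add: jw_sign_def power_add[symmetric] mult_2[symmetric])

lemma jw_sign_square_left [simp]: "jw_sign m T * (jw_sign m T * z) = z"
  by (simp add: mult.assoc[symmetric])

lemma cnj_jw_sign [simp]: "cnj (jw_sign m T) = jw_sign m T"
  by (simp add: jw_sign_def)

lemma fockD: "\<psi> \<in> fock d L \<Longrightarrow> \<not> T \<subseteq> modes d L \<Longrightarrow> \<psi> T = 0"
  by (simp add: fock_def)

lemma fock_ann: "\<psi> \<in> fock d L \<Longrightarrow> ann m \<psi> \<in> fock d L"
  by (auto simp: fock_def ann_def)

lemma fock_cdag: "\<psi> \<in> fock d L \<Longrightarrow> m \<in> modes d L \<Longrightarrow> cdag m \<psi> \<in> fock d L"
proof -
  assume "\<psi> \<in> fock d L" "m \<in> modes d L"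
  then have "\<psi> (T - {m}) = 0" if "\<not> T \<subseteq> modes d L" for T
    by (rule_tac fockD) (use that in auto)
  then show ?thesis by (simp add: fock_def cdag_def)
qed

lemma fock_scale: "\<psi> \<in> fock d L \<Longrightarrow> (\<lambda>T. c * \<psi> T) \<in> fock d L"
  by (auto simp: fock_def)

lemma fock_add: "\<psi> \<in> fock d L \<Longrightarrow> \<phi> \<in> fock d L \<Longrightarrow> (\<lambda>T. \<psi> T + \<phi> T) \<in> fock d L"
  by (auto simp: fock_def)

lemma fock_sum: "(\<And>i. i \<in> I \<Longrightarrow> f i \<in> fock d L) \<Longrightarrow> (\<lambda>T. \<Sum>i\<in>I. f i T) \<in> fock d L"
  by (auto simp: fock_def intro!: sum.neutral)

lemma ann_sum: "ann m (\<lambda>T. \<Sum>i\<in>I. f i T) = (\<lambda>T. \<Sum>i\<in>I. ann m (f i) T)"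
  by (auto simp: ann_def fun_eq_iff sum_distrib_left)

lemma cdag_sum: "cdag m (\<lambda>T. \<Sum>i\<in>I. f i T) = (\<lambda>T. \<Sum>i\<in>I. cdag m (f i) T)"
  by (auto simp: cdag_def fun_eq_iff sum_distrib_left)

lemma ann_add: "ann m (\<lambda>T. \<phi> T + \<psi> T) = (\<lambda>T. ann m \<phi> T + ann m \<psi> T)"
  by (auto simp: ann_def fun_eq_iff algebra_simps)

lemma ann_scale: "ann m (\<lambda>T. c * \<psi> T) = (\<lambda>T. c * ann m \<psi> T)"
  by (auto simp: ann_def fun_eq_iff algebra_simps)

lemma cdag_scale: "cdag m (\<lambda>T. c * \<psi> T) = (\<lambda>T. c * cdag m \<psi> T)"
  by (auto simp: cdag_def fun_eq_iff algebra_simps)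

lemma cdag_uminus: "cdag m (\<lambda>T. - \<psi> T) = (\<lambda>T. - cdag m \<psi> T)"
  by (auto simp: cdag_def fun_eq_iff)

lemma ann_zero: "ann m (\<lambda>T. 0) = (\<lambda>T. 0)"
  by (auto simp: ann_def fun_eq_iff)

lemma cdag_zero: "cdag m (\<lambda>T. 0) = (\<lambda>T. 0)"
  by (auto simp: cdag_def fun_eq_iff)

text \<open>Vectors in \<open>fock\<close> live on finite configurations of lattice modes. There,
  inserting a mode flips the sign of exactly the modes above it, and of the two orders of removing a
  pair exactly one picks up this flip.\<close>

lemma ann_anticommute:
  assumes \<psi>: "\<psi> \<in> fock d L" and m: "m \<in> modes d L" "m' \<in> modes d L" and L: "2 \<le> L"
  shows "ann m (ann m' \<psi>) = (\<lambda>T. - ann m' (ann m \<psi>) T)"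
proof
  fix T
  show "ann m (ann m' \<psi>) T = - ann m' (ann m \<psi>) T"
  proof (cases "T \<subseteq> modes d L \<and> m \<notin> T \<and> m' \<notin> T \<and> m \<noteq> m'")
    case True
    then have fin: "finite T" using finite_subset finite_modes by blast
    show ?thesis using True mode_less_total[OF m L]
      by (auto simp: ann_def jw_sign_insert[OF fin] insert_commute)
  next
    case False
    have "ann m (ann m' \<psi>) T = 0 \<and> ann m' (ann m \<psi>) T = 0"
    proof (cases "T \<subseteq> modes d L")
      case True then show ?thesis using False by (auto simp: ann_def)
    next
      case False then show ?thesis using fockD[OF fock_ann[OF fock_ann[OF \<psi>]]] by blast
    qed
    then show ?thesis by simp
  qed
qed

lemma ann_cdag_anticommute:
  assumes \<psi>: "\<psi> \<in> fock d L" and m: "m \<in> modes d L" "m' \<in> modes d L" and L: "2 \<le> L" and neq: "m \<noteq> m'"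
  shows "ann m (cdag m' \<psi>) = (\<lambda>T. - cdag m' (ann m \<psi>) T)"
proof
  fix T
  show "ann m (cdag m' \<psi>) T = - cdag m' (ann m \<psi>) T"
  proof (cases "T \<subseteq> modes d L \<and> m \<notin> T \<and> m' \<in> T")
    case True
    define R where "R = T - {m'}"
    have T: "T = insert m' R" "m' \<notin> R" "m \<notin> R" using True by (auto simp: R_def)
    have fin: "finite R" using True finite_subset finite_modes R_def by blast
    have e: "insert m (insert m' R) - {m'} = insert m R" "insert m' R - {m'} = R" using T neq by auto
    show ?thesis unfolding T(1) using T neq mode_less_total[OF m L neq]
      by (auto simp: ann_def cdag_def e jw_sign_insert[OF fin] jw_sign_insert[of "insert m R"] insert_commute[of m] fin)
  next
    case False
    have "ann m (cdag m' \<psi>) T = 0 \<and> cdag m' (ann m \<psi>) T = 0"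
    proof (cases "T \<subseteq> modes d L")
      case True then show ?thesis using False neq by (auto simp: ann_def cdag_def)
    next
      case False then show ?thesis
        using fockD[OF fock_ann[OF fock_cdag[OF \<psi> m(2)]]] fockD[OF fock_cdag[OF fock_ann[OF \<psi>] m(2)]] by blast
    qed
    then show ?thesis by simp
  qed
qed

lemma ann_cdag_self: "ann m (cdag m \<psi>) T = (if m \<in> T then 0 else \<psi> T)"
  by (auto simp: ann_def cdag_def)

section \<open>Number operators, inner product and adjoints\<close>

lemma numop_apply: "numop m \<psi> T = (if m \<in> T then \<psi> T else 0)"
  by (auto simp: numop_def cdag_def ann_def insert_absorb)

lemma finner_cdag:
  assumes m: "m \<in> M" and fin: "finite M"
  shows "finner M \<phi> (cdag m \<chi>) = finner M (ann m \<phi>) \<chi>"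
proof -
  have "finner M \<phi> (cdag m \<chi>) = (\<Sum>T\<in>{T \<in> Pow M. m \<in> T}. cnj (\<phi> T) * (jw_sign m T * \<chi> (T - {m})))"
    unfolding finner_def cdag_def using fin by (subst sum.inter_filter) (auto intro!: sum.cong)
  also have "\<dots> = (\<Sum>T\<in>{T \<in> Pow M. m \<notin> T}. cnj (\<phi> (insert m T)) * (jw_sign m T * \<chi> T))"
    by (rule sum.reindex_bij_witness[where i = "insert m" and j = "\<lambda>T. T - {m}"])
       (use m in \<open>auto simp: insert_absorb\<close>)
  also have "\<dots> = finner M (ann m \<phi>) \<chi>"
    unfolding finner_def ann_def using fin by (subst sum.inter_filter) (auto intro!: sum.cong)
  finally show ?thesis .
qed

lemma finner_add_right: "finner M \<phi> (\<lambda>T. \<psi> T + \<chi> T) = finner M \<phi> \<psi> + finner M \<phi> \<chi>"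
  by (simp add: finner_def sum.distrib algebra_simps)

lemma finner_scale_right: "finner M \<phi> (\<lambda>T. c * \<psi> T) = c * finner M \<phi> \<psi>"
  by (simp add: finner_def sum_distrib_left algebra_simps)

lemma finner_sum_right: "finner M \<phi> (\<lambda>T. \<Sum>i\<in>I. f i T) = (\<Sum>i\<in>I. finner M \<phi> (f i))"
  unfolding finner_def by (simp add: sum_distrib_left sum.swap[of _ I])

lemma finner_cnj: "finner M \<phi> \<psi> = cnj (finner M \<psi> \<phi>)"
  by (simp add: finner_def mult.commute)

lemma finner_self: "finner M \<psi> \<psi> = of_real (\<Sum>T\<in>Pow M. (cmod (\<psi> T))\<^sup>2)"
  unfolding finner_def of_real_sum by (rule sum.cong) (simp_all add: complex_norm_square mult.commute del: of_real_power)

lemma finner_bond: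
  assumes b: "b \<in> lat_B d L"
  shows "finner (modes d L) \<phi> (bond_cdag lam \<sigma> b \<chi>) = finner (modes d L) (bond_ann lam \<sigma> b \<phi>) \<chi>"
proof -
  let ?M = "modes d L"
  have "finner ?M \<phi> (bond_cdag lam \<sigma> b \<chi>)
      = (\<Sum>x\<in>b. finner ?M \<phi> (cdag (Vtx x, \<sigma>) \<chi>)) + of_real lam * finner ?M \<phi> (cdag (Mid b, \<sigma>) \<chi>)"
    unfolding bond_cdag_def op_add_def op_scale_def op_sum_def
    by (simp add: finner_add_right finner_sum_right finner_scale_right)
  also have "\<dots> = (\<Sum>x\<in>b. finner ?M (ann (Vtx x, \<sigma>) \<phi>) \<chi>) + of_real lam * finner ?M (ann (Mid b, \<sigma>) \<phi>) \<chi>"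
    using bond_vtx_mode[OF b] Mid_mode[OF b] by (simp add: finner_cdag)
  also have "\<dots> = cnj (finner ?M \<chi> (bond_ann lam \<sigma> b \<phi>))"
    unfolding bond_ann_def op_add_def op_scale_def op_sum_def
    by (simp add: finner_add_right finner_sum_right finner_scale_right finner_cnj[of ?M _ \<chi>])
  finally show ?thesis by (simp add: finner_cnj[of ?M _ \<chi>])
qed

section \<open>Characterisation of the ground space\<close>

lemma bond_ann_apply:
  "bond_ann lam \<sigma> b \<psi> = (\<lambda>T. (\<Sum>x\<in>b. ann (Vtx x, \<sigma>) \<psi> T) + of_real lam * ann (Mid b, \<sigma>) \<psi> T)"
  by (auto simp: bond_ann_def op_add_def op_scale_def op_sum_def fun_eq_iff)

lemma fock_bond_ann: "\<psi> \<in> fock d L \<Longrightarrow> bond_ann lam \<sigma> b \<psi> \<in> fock d L"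
  unfolding bond_ann_apply by (intro fock_add fock_sum fock_scale fock_ann)

definition double_free :: "fvec \<Rightarrow> bool" where
  "double_free \<psi> \<longleftrightarrow> (\<forall>s T. (s, True) \<in> T \<and> (s, False) \<in> T \<longrightarrow> \<psi> T = 0)"

lemma double_freeD: "double_free \<psi> \<Longrightarrow> (s, True) \<in> T \<Longrightarrow> (s, False) \<in> T \<Longrightarrow> \<psi> T = 0"
  by (auto simp: double_free_def)

lemma Ham_apply:
  "Ham d L t lam U U' \<psi> T =
     (\<Sum>p\<in>UNIV \<times> lat_B d L. of_real t * bond_cdag lam (fst p) (snd p) (bond_ann lam (fst p) (snd p) \<psi>) T)
     + ((\<Sum>u\<in>lat_V d L. of_real U * (if (Vtx u, True) \<in> T \<and> (Vtx u, False) \<in> T then \<psi> T else 0))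
     + (\<Sum>b\<in>lat_B d L. of_real U' * (if (Mid b, True) \<in> T \<and> (Mid b, False) \<in> T then \<psi> T else 0)))"
  unfolding Ham_def H_hop_def H_int_def op_add_def op_scale_def op_sum_def
  by (auto simp: numop_apply split_beta intro!: arg_cong2[where f = "(+)"] sum.cong)

lemma ground_space_iff:
  assumes t: "0 < t" and U: "0 < U" "0 < U'"
  shows "\<psi> \<in> ground_space d L t lam U U' \<longleftrightarrow>
    \<psi> \<in> fock d L \<and> (\<forall>b\<in>lat_B d L. \<forall>\<sigma>. bond_ann lam \<sigma> b \<psi> = (\<lambda>_. 0)) \<and> double_free \<psi>"
proof
  let ?M = "modes d L"
  assume "\<psi> \<in> ground_space d L t lam U U'"
  then have \<psi>: "\<psi> \<in> fock d L" and H: "Ham d L t lam U U' \<psi> = (\<lambda>_. 0)" by (auto simp: ground_space_def)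
  define q where "q \<phi> = (\<Sum>T\<in>Pow ?M. (cmod (\<phi> T))\<^sup>2)" for \<phi> :: fvec
  \<comment> \<open>Truncation of \<open>\<psi>\<close> to configurations with \<open>s\<close>
    doubly occupied; its pairing with \<open>\<psi>\<close> is its own squared norm.\<close>
  define D where "D s = (\<lambda>T. if (s, True) \<in> T \<and> (s, False) \<in> T then \<psi> T else 0)" for s :: site
  have q0: "0 \<le> q \<phi>" for \<phi> by (auto simp: q_def intro!: sum_nonneg)
  have qz: "\<phi> T = 0" if "q \<phi> = 0" "T \<subseteq> ?M" for \<phi> T
  proof -
    have "\<forall>T\<in>Pow ?M. (cmod (\<phi> T))\<^sup>2 = 0"
      using that(1) unfolding q_def by (subst (asm) sum_nonneg_eq_0_iff) auto
    then show ?thesis using that(2) by auto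
  qed
  have fD: "finner ?M \<psi> (D s) = of_real (q (D s))" for s
  proof -
    have "finner ?M \<psi> (D s) = finner ?M (D s) (D s)"
      unfolding finner_def D_def by (rule sum.cong) auto
    then show ?thesis by (simp only: finner_self q_def)
  qed
  have fB: "finner ?M \<psi> (bond_cdag lam \<sigma> b (bond_ann lam \<sigma> b \<psi>)) = of_real (q (bond_ann lam \<sigma> b \<psi>))"
    if "b \<in> lat_B d L" for \<sigma> b
    by (simp only: finner_bond[OF that] finner_self q_def)
  define hop where "hop = (\<Sum>p\<in>UNIV \<times> lat_B d L. t * q (bond_ann lam (fst p) (snd p) \<psi>))"
  define i1 where "i1 = (\<Sum>u\<in>lat_V d L. U * q (D (Vtx u)))"
  define i2 where "i2 = (\<Sum>b\<in>lat_B d L. U' * q (D (Mid b)))"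
  have "0 = finner ?M \<psi> (Ham d L t lam U U' \<psi>)" by (simp add: H finner_def)
  also have "Ham d L t lam U U' \<psi> = (\<lambda>T.
     (\<Sum>p\<in>UNIV \<times> lat_B d L. of_real t * bond_cdag lam (fst p) (snd p) (bond_ann lam (fst p) (snd p) \<psi>) T)
     + ((\<Sum>u\<in>lat_V d L. of_real U * D (Vtx u) T) + (\<Sum>b\<in>lat_B d L. of_real U' * D (Mid b) T)))"
    by (rule ext) (simp only: Ham_apply D_def)
  also have "finner ?M \<psi> \<dots> = of_real (hop + (i1 + i2))"
    unfolding finner_add_right finner_sum_right finner_scale_right hop_def i1_def i2_def
    by (simp add: fD) (auto simp: fB intro!: sum.cong)
  finally have "hop + (i1 + i2) = 0" by (metis of_real_eq_0_iff)
  moreover have "0 \<le> hop" "0 \<le> i1" "0 \<le> i2"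
    using t U q0 by (auto simp: hop_def i1_def i2_def intro!: sum_nonneg mult_nonneg_nonneg)
  ultimately have z: "hop = 0" "i1 = 0" "i2 = 0" by linarith+
  have zh: "q (bond_ann lam \<sigma> b \<psi>) = 0" if "b \<in> lat_B d L" for \<sigma> b
  proof -
    have "\<forall>p\<in>UNIV \<times> lat_B d L. t * q (bond_ann lam (fst p) (snd p) \<psi>) = 0"
      using z(1) t q0 unfolding hop_def by (subst (asm) sum_nonneg_eq_0_iff) auto
    then have "t * q (bond_ann lam (fst (\<sigma>, b)) (snd (\<sigma>, b)) \<psi>) = 0" using that by blast
    then show ?thesis using t by simp
  qed
  have z1: "q (D (Vtx u)) = 0" if "u \<in> lat_V d L" for u
    using z(2) U q0 that unfolding i1_def by (subst (asm) sum_nonneg_eq_0_iff) auto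
  have z2: "q (D (Mid b)) = 0" if "b \<in> lat_B d L" for b
    using z(3) U q0 that unfolding i2_def by (subst (asm) sum_nonneg_eq_0_iff) auto
  have "bond_ann lam \<sigma> b \<psi> = (\<lambda>_. 0)" if b: "b \<in> lat_B d L" for \<sigma> b
  proof
    fix T show "bond_ann lam \<sigma> b \<psi> T = 0"
      by (cases "T \<subseteq> ?M") (simp_all add: qz[OF zh[OF b]] fockD[OF fock_bond_ann[OF \<psi>]])
  qed
  moreover have "double_free \<psi>" unfolding double_free_def
  proof (intro allI impI)
    fix s :: site and T :: "mode set" assume sT: "(s, True) \<in> T \<and> (s, False) \<in> T"
    show "\<psi> T = 0"
    proof (cases "T \<subseteq> ?M")
      case True
      then have "s \<in> lat_Lambda d L" using sT by (auto simp: modes_def)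
      then have "q (D s) = 0" using z1 z2 by (auto simp: lat_Lambda_def)
      then show ?thesis using qz[of "D s" T] True sT by (simp add: D_def)
    qed (rule fockD[OF \<psi>])
  qed
  ultimately show "\<psi> \<in> fock d L \<and> (\<forall>b\<in>lat_B d L. \<forall>\<sigma>. bond_ann lam \<sigma> b \<psi> = (\<lambda>_. 0)) \<and> double_free \<psi>"
    using \<psi> by blast
next
  assume a: "\<psi> \<in> fock d L \<and> (\<forall>b\<in>lat_B d L. \<forall>\<sigma>. bond_ann lam \<sigma> b \<psi> = (\<lambda>_. 0)) \<and> double_free \<psi>"
  have "bond_cdag lam \<sigma> b (\<lambda>_. 0) T = 0" for \<sigma> b T
    by (simp add: bond_cdag_def op_add_def op_scale_def op_sum_def cdag_zero)
  moreover have "(if (s, True) \<in> T \<and> (s, False) \<in> T then \<psi> T else 0) = 0" for s T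
    using a double_freeD by auto
  ultimately have "Ham d L t lam U U' \<psi> T = 0" for T
    using a unfolding Ham_apply by (simp, intro sum.neutral) auto
  then show "\<psi> \<in> ground_space d L t lam U U'" using a by (auto simp: ground_space_def)
qed

subsection \<open>Extending vertex amplitudes to the midpoints\<close>

definition vann :: "nat list set \<Rightarrow> bool \<Rightarrow> fop" where
  "vann b \<sigma> \<psi> = (\<lambda>T. \<Sum>x\<in>b. ann (Vtx x, \<sigma>) \<psi> T)"

text \<open>The coefficient solves the bond equation. On a state without the midpoint mode,
  \<open>vann\<close> of the added term vanishes because \<open>vann b \<sigma>\<close> squares to
  zero, and \<open>lam\<close> times annihilation of the midpoint gives minus
  \<open>vann b \<sigma> \<psi>\<close>.\<close>

definition kop :: "real \<Rightarrow> nat list set \<Rightarrow> bool \<Rightarrow> fop" where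
  "kop lam b \<sigma> \<psi> = (\<lambda>T. - (1 / of_real lam) * cdag (Mid b, \<sigma>) (vann b \<sigma> \<psi>) T)"

text \<open>Multiplying by \<open>1 + kop\<close> for every midpoint mode replaces each vertex creation operator by the
  creation operator of the localised zero-energy orbital at that vertex.\<close>

fun ext_mid :: "real \<Rightarrow> (nat list set \<times> bool) list \<Rightarrow> fop" where
  "ext_mid lam [] g = g"
| "ext_mid lam (p # ps) g = (\<lambda>T. ext_mid lam ps g T + kop lam (fst p) (snd p) (ext_mid lam ps g) T)"

lemma bond_ann_vann: "bond_ann lam \<sigma> b \<psi> = (\<lambda>T. vann b \<sigma> \<psi> T + of_real lam * ann (Mid b, \<sigma>) \<psi> T)"
  by (simp add: bond_ann_apply vann_def)

lemma fock_vann: "\<psi> \<in> fock d L \<Longrightarrow> vann b \<sigma> \<psi> \<in> fock d L"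
  unfolding vann_def by (intro fock_sum fock_ann)

lemma fock_kop: "\<psi> \<in> fock d L \<Longrightarrow> b \<in> lat_B d L \<Longrightarrow> kop lam b \<sigma> \<psi> \<in> fock d L"
  unfolding kop_def by (intro fock_scale fock_cdag fock_vann Mid_mode)

lemma fock_ext_mid:
  "g \<in> fock d L \<Longrightarrow> set ps \<subseteq> lat_B d L \<times> UNIV \<Longrightarrow> ext_mid lam ps g \<in> fock d L"
  by (induction ps) (auto intro!: fock_add fock_kop)

section \<open>Commutation rules for the midpoint extension\<close>

lemma vann_sum: "vann b \<sigma> (\<lambda>T. \<Sum>i\<in>I. f i T) = (\<lambda>T. \<Sum>i\<in>I. vann b \<sigma> (f i) T)"
  by (simp add: vann_def ann_sum sum.swap[of _ b I])

lemma vann_add: "vann b \<sigma> (\<lambda>T. \<phi> T + \<psi> T) = (\<lambda>T. vann b \<sigma> \<phi> T + vann b \<sigma> \<psi> T)"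
  by (simp add: vann_def ann_add sum.distrib)

lemma vann_scale: "vann b \<sigma> (\<lambda>T. c * \<psi> T) = (\<lambda>T. c * vann b \<sigma> \<psi> T)"
  by (simp add: vann_def ann_scale sum_distrib_left)

lemma vann_zero: "vann b \<sigma> (\<lambda>T. 0) = (\<lambda>T. 0)"
  by (simp add: vann_def ann_zero)

lemma kop_zero: "kop lam b \<sigma> (\<lambda>T. 0) = (\<lambda>T. 0)"
  by (simp add: kop_def vann_zero cdag_zero)

lemma kop_sum: "kop lam b \<sigma> (\<lambda>T. \<Sum>i\<in>I. f i T) = (\<lambda>T. \<Sum>i\<in>I. kop lam b \<sigma> (f i) T)"
  unfolding kop_def vann_sum cdag_sum by (simp add: sum_distrib_left)

lemma cdag_add: "cdag m (\<lambda>T. \<phi> T + \<psi> T) = (\<lambda>T. cdag m \<phi> T + cdag m \<psi> T)"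
  by (auto simp: cdag_def fun_eq_iff algebra_simps)

lemma kop_add: "kop lam b \<sigma> (\<lambda>T. \<phi> T + \<psi> T) = (\<lambda>T. kop lam b \<sigma> \<phi> T + kop lam b \<sigma> \<psi> T)"
  unfolding kop_def vann_add cdag_add by (simp add: algebra_simps)

lemma kop_scale: "kop lam b \<sigma> (\<lambda>T. c * \<psi> T) = (\<lambda>T. c * kop lam b \<sigma> \<psi> T)"
  unfolding kop_def vann_scale cdag_scale by (simp add: algebra_simps)

lemma ext_mid_zero: "ext_mid lam ps (\<lambda>T. 0) = (\<lambda>T. 0)"
  by (induction ps) (auto simp: kop_zero)

lemma jw_sign_nonzero [simp]: "jw_sign m T \<noteq> 0"
  by (simp add: jw_sign_def)

lemma ann_eq_0D:
  assumes "ann m \<chi> = (\<lambda>T. 0)" "m \<in> T" shows "\<chi> T = 0"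
  using fun_cong[OF assms(1), of "T - {m}"] assms(2) by (simp add: ann_def insert_absorb)

lemma ann_vann:
  assumes "\<psi> \<in> fock d L" "m \<in> modes d L" "b \<in> lat_B d L" "2 \<le> L"
  shows "ann m (vann b \<sigma> \<psi>) = (\<lambda>T. - vann b \<sigma> (ann m \<psi>) T)"
proof -
  have "ann m (ann (Vtx x, \<sigma>) \<psi>) T = - ann (Vtx x, \<sigma>) (ann m \<psi>) T" if "x \<in> b" for x T
    using ann_anticommute[OF assms(1,2) bond_vtx_mode[OF assms(3) that] assms(4)] by simp
  then show ?thesis unfolding vann_def ann_sum by (simp add: sum_negf)
qed

text \<open>\<open>kop\<close> contains two fermion operators, so an annihilator of a different mode
  picks up two sign changes, which cancel.\<close>

lemma ann_kop:
  assumes "\<psi> \<in> fock d L" "m \<in> modes d L" "b \<in> lat_B d L" "2 \<le> L" "m \<noteq> (Mid b, \<sigma>)"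
  shows "ann m (kop lam b \<sigma> \<psi>) = kop lam b \<sigma> (ann m \<psi>)"
  unfolding kop_def ann_scale
  by (simp add: ann_cdag_anticommute[OF fock_vann[OF assms(1)] assms(2) Mid_mode[OF assms(3)] assms(4,5)]
      ann_vann[OF assms(1-4)] cdag_uminus)

lemma vann_kop:
  assumes "\<psi> \<in> fock d L" "c \<in> lat_B d L" "b \<in> lat_B d L" "2 \<le> L"
  shows "vann c \<tau> (kop lam b \<sigma> \<psi>) = kop lam b \<sigma> (vann c \<tau> \<psi>)"
proof -
  have "ann (Vtx x, \<tau>) (kop lam b \<sigma> \<psi>) = kop lam b \<sigma> (ann (Vtx x, \<tau>) \<psi>)" if "x \<in> c" for x
    using ann_kop[OF assms(1) bond_vtx_mode[OF assms(2) that] assms(3,4)] by simp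
  then show ?thesis unfolding vann_def kop_sum by simp
qed

text \<open>The double sum over the bond is antisymmetric under exchange of its two summation
  vertices.\<close>

lemma vann_nilpotent:
  assumes "\<psi> \<in> fock d L" "b \<in> lat_B d L" "2 \<le> L"
  shows "vann b \<sigma> (vann b \<sigma> \<psi>) = (\<lambda>T. 0)"
proof
  fix T
  let ?a = "\<lambda>x y. ann (Vtx x, \<sigma>) (ann (Vtx y, \<sigma>) \<psi>) T"
  have e: "vann b \<sigma> (vann b \<sigma> \<psi>) T = (\<Sum>x\<in>b. \<Sum>y\<in>b. ?a x y)" by (simp add: vann_def ann_sum)
  have "(\<Sum>x\<in>b. \<Sum>y\<in>b. ?a x y) = (\<Sum>x\<in>b. \<Sum>y\<in>b. - ?a y x)"
  proof (intro sum.cong refl)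
    fix x y assume "x \<in> b" "y \<in> b"
    then show "?a x y = - ?a y x"
      by (intro fun_cong[OF ann_anticommute[OF assms(1) bond_vtx_mode[OF assms(2)] bond_vtx_mode[OF assms(2)] assms(3)]])
  qed
  also have "\<dots> = - (\<Sum>x\<in>b. \<Sum>y\<in>b. ?a x y)" by (subst sum.swap) (simp add: sum_negf)
  finally show "vann b \<sigma> (vann b \<sigma> \<psi>) T = 0" using e by simp
qed

lemma ann_ext_mid:
  assumes "g \<in> fock d L" "m \<in> modes d L" "2 \<le> L" "set ps \<subseteq> lat_B d L \<times> UNIV"
    "\<And>b \<sigma>. (b, \<sigma>) \<in> set ps \<Longrightarrow> m \<noteq> (Mid b, \<sigma>)"
  shows "ann m (ext_mid lam ps g) = ext_mid lam ps (ann m g)"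
  using assms(4,5)
proof (induction ps)
  case (Cons p ps)
  have "ann m (kop lam (fst p) (snd p) (ext_mid lam ps g)) = kop lam (fst p) (snd p) (ann m (ext_mid lam ps g))"
    by (rule ann_kop[OF fock_ext_mid[OF assms(1)] assms(2)]) (use Cons.prems assms(3) in auto)
  then show ?case using Cons by (simp add: ann_add)
qed simp

lemma vann_ext_mid:
  assumes "g \<in> fock d L" "c \<in> lat_B d L" "2 \<le> L" "set ps \<subseteq> lat_B d L \<times> UNIV"
  shows "vann c \<tau> (ext_mid lam ps g) = ext_mid lam ps (vann c \<tau> g)"
  using assms(4)
proof (induction ps)
  case (Cons p ps)
  have "vann c \<tau> (kop lam (fst p) (snd p) (ext_mid lam ps g)) = kop lam (fst p) (snd p) (vann c \<tau> (ext_mid lam ps g))"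
    by (rule vann_kop[OF fock_ext_mid[OF assms(1)] assms(2)]) (use Cons.prems assms(3) in auto)
  then show ?case using Cons by (simp add: vann_add)
qed simp

text \<open>The factor for \<open>(b, \<sigma>)\<close> establishes the bond equation: by
  distinctness, the factors applied before it have not touched this midpoint mode. Factors for other
  modes commute with \<open>bond_ann lam \<sigma> b\<close> and preserve the equation.\<close>

lemma bond_ann_ext_mid:
  assumes g: "g \<in> fock d L" and L: "2 \<le> L" and lam: "lam \<noteq> 0" and b: "b \<in> lat_B d L"
    and g0: "ann (Mid b, \<sigma>) g = (\<lambda>T. 0)"
    and ps: "set ps \<subseteq> lat_B d L \<times> UNIV" "distinct ps" "(b, \<sigma>) \<in> set ps"
  shows "bond_ann lam \<sigma> b (ext_mid lam ps g) = (\<lambda>T. 0)"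
  using ps
proof (induction ps)
  case (Cons p ps)
  let ?m = "(Mid b, \<sigma>)"
  define \<phi> where "\<phi> = ext_mid lam ps g"
  have \<phi>: "\<phi> \<in> fock d L" unfolding \<phi>_def using fock_ext_mid[OF g] Cons.prems by auto
  have pB: "fst p \<in> lat_B d L" using Cons.prems by auto
  have e: "ext_mid lam (p # ps) g = (\<lambda>T. \<phi> T + kop lam (fst p) (snd p) \<phi> T)" by (simp add: \<phi>_def)
  show ?case
  proof (cases "p = (b, \<sigma>)")
    case True
    have "?m \<noteq> (Mid c, \<tau>)" if "(c, \<tau>) \<in> set ps" for c \<tau>
      using Cons.prems(2) True that by (metis distinct.simps(2) prod.inject site.inject(2))
    moreover have "set ps \<subseteq> lat_B d L \<times> UNIV" using Cons.prems by simp
    ultimately have "ann ?m \<phi> = ext_mid lam ps (ann ?m g)"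
      unfolding \<phi>_def by (intro ann_ext_mid[OF g Mid_mode[OF b] L])
    then have a0: "ann ?m \<phi> = (\<lambda>T. 0)" by (simp add: g0 ext_mid_zero)
    have v: "vann b \<sigma> (kop lam b \<sigma> \<phi>) = (\<lambda>T. 0)"
      by (simp only: vann_kop[OF \<phi> b b L]) (simp add: kop_def vann_nilpotent[OF \<phi> b L] cdag_zero)
    have "ann ?m (vann b \<sigma> \<phi>) = (\<lambda>T. 0)"
      unfolding ann_vann[OF \<phi> Mid_mode[OF b] b L] a0 by (simp add: vann_zero)
    \<comment> \<open>The midpoint mode is absent from \<open>vann b \<sigma> \<phi>\<close>, so
      creating and then annihilating it returns the same vector.\<close>
    then have "vann b \<sigma> \<phi> T = 0" if "?m \<in> T" for T using that by (rule ann_eq_0D)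
    then have k: "ann ?m (kop lam b \<sigma> \<phi>) = (\<lambda>T. - (1 / of_real lam) * vann b \<sigma> \<phi> T)"
      unfolding kop_def ann_scale ann_cdag_self by (auto simp: fun_eq_iff)
    have e': "ext_mid lam (p # ps) g = (\<lambda>T. \<phi> T + kop lam b \<sigma> \<phi> T)" using e True by simp
    show ?thesis unfolding e' bond_ann_vann vann_add ann_add v k a0 using lam by simp
  next
    case False
    have ih: "bond_ann lam \<sigma> b \<phi> = (\<lambda>T. 0)" unfolding \<phi>_def using Cons False by auto
    have "vann b \<sigma> (kop lam (fst p) (snd p) \<phi>) = kop lam (fst p) (snd p) (vann b \<sigma> \<phi>)"
      by (rule vann_kop[OF \<phi> b pB L])
    moreover have "ann ?m (kop lam (fst p) (snd p) \<phi>) = kop lam (fst p) (snd p) (ann ?m \<phi>)"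
      by (rule ann_kop[OF \<phi> Mid_mode[OF b] pB L]) (use False in \<open>auto simp: prod_eq_iff\<close>)
    ultimately have "bond_ann lam \<sigma> b (kop lam (fst p) (snd p) \<phi>) = kop lam (fst p) (snd p) (bond_ann lam \<sigma> b \<phi>)"
      unfolding bond_ann_vann kop_add kop_scale by simp
    then have "bond_ann lam \<sigma> b (kop lam (fst p) (snd p) \<phi>) = (\<lambda>T. 0)" by (simp add: ih kop_zero)
    then have z: "vann b \<sigma> (kop lam (fst p) (snd p) \<phi>) T
        + of_real lam * ann ?m (kop lam (fst p) (snd p) \<phi>) T = 0" for T
      unfolding bond_ann_vann by (rule fun_cong)
    have z': "vann b \<sigma> \<phi> T + of_real lam * ann ?m \<phi> T = 0" for T
      using ih unfolding bond_ann_vann by (rule fun_cong)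
    show ?thesis unfolding e bond_ann_vann vann_add ann_add
    proof
      fix T
      show "vann b \<sigma> \<phi> T + vann b \<sigma> (kop lam (fst p) (snd p) \<phi>) T
        + of_real lam * (ann ?m \<phi> T + ann ?m (kop lam (fst p) (snd p) \<phi>) T) = 0"
        using z[of T] z'[of T] by (simp add: algebra_simps)
    qed
  qed
qed simp

text \<open>Every term added by the extension contains a midpoint mode; vertex amplitudes survive
  and can serve as coordinates.\<close>

lemma ext_mid_vertex:
  assumes "\<And>b \<sigma>. (Mid b, \<sigma>) \<notin> T"
  shows "ext_mid lam ps g T = g T"
  using assms by (induction ps) (auto simp: kop_def cdag_def)

text \<open>\<open>kop\<close> moves one particle from a vertex to a midpoint, so particle number is
  conserved.\<close>

lemma ext_mid_card:
  assumes g: "\<And>T. T \<subseteq> modes d L \<Longrightarrow> card T \<noteq> n \<Longrightarrow> g T = 0"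
    and ps: "set ps \<subseteq> lat_B d L \<times> UNIV"
    and T: "T \<subseteq> modes d L" "card T \<noteq> n"
  shows "ext_mid lam ps g T = 0"
  using ps T
proof (induction ps arbitrary: T)
  case Nil then show ?case using g by simp
next
  case (Cons p ps)
  have fin: "finite T" using Cons.prems finite_subset finite_modes by blast
  have "kop lam (fst p) (snd p) (ext_mid lam ps g) T = 0"
  proof (cases "(Mid (fst p), snd p) \<in> T")
    case True
    let ?T = "T - {(Mid (fst p), snd p)}"
    have "ann (Vtx x, snd p) (ext_mid lam ps g) ?T = 0" if "x \<in> fst p" for x
    proof (cases "(Vtx x, snd p) \<in> T")
      case False
      have "card (insert (Vtx x, snd p) ?T) = card T" 
        by (subst card_insert_disjoint)
           (use fin False card_Suc_Diff1[OF fin True] in \<open>auto simp del: card_Diff_singleton\<close>)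
      moreover have "insert (Vtx x, snd p) ?T \<subseteq> modes d L"
        using Cons.prems bond_vtx_mode[OF _ that] by auto
      ultimately have "ext_mid lam ps g (insert (Vtx x, snd p) ?T) = 0"
        using Cons.IH Cons.prems by auto
      then show ?thesis by (simp add: ann_def)
    qed (simp add: ann_def)
    then show ?thesis using True by (simp add: kop_def cdag_def vann_def)
  qed (simp add: kop_def cdag_def)
  then show ?case using Cons by auto
qed

text \<open>The operator form is the one that can be carried through \<open>ext_mid\<close> and
  combined with the bond equations.\<close>

lemma double_occupied_iff:
  "(\<forall>T. (s, True) \<in> T \<and> (s, False) \<in> T \<longrightarrow> \<psi> T = 0) \<longleftrightarrow> ann (s, True) (ann (s, False) \<psi>) = (\<lambda>T. 0)"
proof
  assume "\<forall>T. (s, True) \<in> T \<and> (s, False) \<in> T \<longrightarrow> \<psi> T = 0"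
  then show "ann (s, True) (ann (s, False) \<psi>) = (\<lambda>T. 0)" by (auto simp: ann_def fun_eq_iff)
next
  assume a: "ann (s, True) (ann (s, False) \<psi>) = (\<lambda>T. 0)"
  show "\<forall>T. (s, True) \<in> T \<and> (s, False) \<in> T \<longrightarrow> \<psi> T = 0"
  proof (intro allI impI)
    fix T assume T: "(s, True) \<in> T \<and> (s, False) \<in> T"
    then have "insert (s, False) (insert (s, True) (T - {(s, True), (s, False)})) = T" by auto
    then show "\<psi> T = 0" using fun_cong[OF a, of "T - {(s, True), (s, False)}"]
      by (simp add: ann_def)
  qed
qed

text \<open>On a state satisfying the bond equations each midpoint annihilator acts as -1 / lam
  times \<open>vann\<close>. Absence of double occupancy at a midpoint thereby becomes an equation
  in vertex operators alone.\<close>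

lemma ann_Mid_pair:
  assumes \<psi>: "\<psi> \<in> fock d L" and b: "b \<in> lat_B d L" and L: "2 \<le> L" and lam: "lam \<noteq> 0"
    and z: "\<And>\<sigma>. bond_ann lam \<sigma> b \<psi> = (\<lambda>T. 0)"
  shows "ann (Mid b, True) (ann (Mid b, False) \<psi>)
    = (\<lambda>T. - (1 / of_real lam) * ((1 / of_real lam) * vann b False (vann b True \<psi>) T))"
proof -
  have a: "ann (Mid b, \<sigma>) \<psi> = (\<lambda>T. - (1 / of_real lam) * vann b \<sigma> \<psi> T)" for \<sigma>
  proof
    fix T
    have "vann b \<sigma> \<psi> T + of_real lam * ann (Mid b, \<sigma>) \<psi> T = 0"
      using z[of \<sigma>] unfolding bond_ann_vann by (rule fun_cong)
    then show "ann (Mid b, \<sigma>) \<psi> T = - (1 / of_real lam) * vann b \<sigma> \<psi> T"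
      using lam by (simp add: field_simps add_eq_0_iff)
  qed
  show ?thesis unfolding a ann_scale ann_vann[OF \<psi> Mid_mode[OF b] b L] vann_scale by simp
qed

subsection \<open>Spin exchange\<close>

definition spin_config :: "nat list set \<Rightarrow> nat list set \<Rightarrow> mode set" where
  "spin_config X A = (\<lambda>a. (Vtx a, True)) ` A \<union> (\<lambda>a. (Vtx a, False)) ` (X - A)"

text \<open>The sign of the permutation that sorts the occupied vertices when the modes are ordered with all
  down spins before all up spins. After this change of gauge the zero-energy condition on a bond
  becomes plain invariance under exchanging its two spins.\<close>

definition gauge_sign :: "nat list set \<Rightarrow> nat list set \<Rightarrow> complex" where
  "gauge_sign A B = (-1) ^ card {p \<in> A \<times> B. fst p < snd p}"

definition gauged :: "fvec \<Rightarrow> nat list set \<Rightarrow> nat list set \<Rightarrow> complex" where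
  "gauged \<psi> X A = gauge_sign A (X - A) * \<psi> (spin_config X A)"

definition ups :: "mode set \<Rightarrow> nat list set" where
  "ups T = {a. (Vtx a, True) \<in> T}"

lemma mem_spin_config [simp]:
  "(Vtx a, True) \<in> spin_config X A \<longleftrightarrow> a \<in> A"
  "(Vtx a, False) \<in> spin_config X A \<longleftrightarrow> a \<in> X - A"
  "(Mid b, \<sigma>) \<notin> spin_config X A"
  by (auto simp: spin_config_def)

lemma ups_spin_config [simp]: "ups (spin_config X A) = A"
  by (simp add: ups_def)

lemma gauge_sign_square [simp]: "gauge_sign A B * gauge_sign A B = 1"
  by (simp add: gauge_sign_def power_add[symmetric] mult_2[symmetric])

lemma gauge_sign_square_left [simp]: "gauge_sign A B * (gauge_sign A B * z) = z"
  by (simp add: mult.assoc[symmetric])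

lemma gauged_inverse: "\<psi> (spin_config X A) = gauge_sign A (X - A) * gauged \<psi> X A"
  by (simp add: gauged_def)

lemma spin_config_inject:
  assumes "A \<subseteq> X" "A' \<subseteq> X'" "spin_config X A = spin_config X' A'"
  shows "X = X' \<and> A = A'"
proof -
  have A: "A = A'" using arg_cong[OF assms(3), of ups] by simp
  moreover have "X - A = X' - A'"
    using assms(3) mem_spin_config(2)[of _ X A] mem_spin_config(2)[of _ X' A'] by blast
  ultimately show ?thesis using assms by blast
qed

lemma card_spin_config:
  assumes "finite X" "A \<subseteq> X" shows "card (spin_config X A) = card X"
proof -
  have fin: "finite A" using assms finite_subset by blast
  have "card (spin_config X A) = card A + card (X - A)"
    unfolding spin_config_def using assms fin
    by (subst card_Un_disjoint) (auto simp: card_image inj_on_def)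
  also have "\<dots> = card X" using assms fin by (metis card_Diff_subset card_mono le_add_diff_inverse)
  finally show ?thesis .
qed

lemma spin_config_subset: "A \<subseteq> X \<Longrightarrow> X \<subseteq> lat_V d L \<Longrightarrow> spin_config X A \<subseteq> modes d L"
  by (auto simp: spin_config_def intro!: Vtx_mode)

lemma spin_config_insert_up:
  "w \<notin> X \<Longrightarrow> insert (Vtx w, True) (spin_config X A) = spin_config (insert w X) (insert w A)"
  by (auto simp: spin_config_def)

lemma spin_config_insert_down:
  "w \<notin> X \<Longrightarrow> A \<subseteq> X \<Longrightarrow> insert (Vtx w, False) (spin_config X A) = spin_config (insert w X) A"
  by (auto simp: spin_config_def)

section \<open>Sign bookkeeping for one bond\<close>

lemma mode_less_Vtx [simp]:
  "mode_less (Vtx a, True) (Vtx b, True) \<longleftrightarrow> a < b"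
  "mode_less (Vtx a, False) (Vtx b, False) \<longleftrightarrow> a < b"
  "mode_less (Vtx a, False) (Vtx b, True)"
  "\<not> mode_less (Vtx a, True) (Vtx b, False)"
  by (simp_all add: mode_less_def mode_key_def)

lemma jw_sign_up:
  assumes "finite X" "A \<subseteq> X"
  shows "jw_sign (Vtx x, True) (spin_config X A) = (-1) ^ (card (X - A) + card {a \<in> A. a < x})"
proof -
  have fin: "finite A" using assms finite_subset by blast
  have "{m \<in> spin_config X A. mode_less m (Vtx x, True)}
      = (\<lambda>a. (Vtx a, False)) ` (X - A) \<union> (\<lambda>a. (Vtx a, True)) ` {a \<in> A. a < x}"
    by (auto simp: spin_config_def)
  then have "card {m \<in> spin_config X A. mode_less m (Vtx x, True)} = card (X - A) + card {a \<in> A. a < x}"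
    using assms fin by (simp, subst card_Un_disjoint) (auto simp: card_image inj_on_def)
  then show ?thesis by (simp add: jw_sign_def)
qed

lemma jw_sign_down:
  "jw_sign (Vtx x, False) (spin_config X A) = (-1) ^ card {a \<in> X - A. a < x}"
proof -
  have "{m \<in> spin_config X A. mode_less m (Vtx x, False)} = (\<lambda>a. (Vtx a, False)) ` {a \<in> X - A. a < x}"
    by (auto simp: spin_config_def)
  then have "card {m \<in> spin_config X A. mode_less m (Vtx x, False)} = card {a \<in> X - A. a < x}"
    by (simp add: card_image inj_on_def)
  then show ?thesis by (simp add: jw_sign_def)
qed

lemma card_inversions_insert:
  fixes A B :: "'a::linorder set"
  assumes "finite A" "finite B" "w \<notin> A" "v \<notin> B"
  shows "card {p \<in> insert w A \<times> insert v B. fst p < snd p}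
    = card {p \<in> A \<times> B. fst p < snd p} + card {a \<in> A. a < v} + card {b \<in> B. w < b} + (if w < v then 1 else 0)"
proof -
  let ?I = "{p \<in> A \<times> B. fst p < snd p}" and ?J = "(\<lambda>a. (a, v)) ` {a \<in> A. a < v}"
    and ?K = "(\<lambda>b. (w, b)) ` {b \<in> B. w < b}" and ?N = "if w < v then {(w, v)} else {}"
  have "{p \<in> insert w A \<times> insert v B. fst p < snd p} = ?I \<union> (?J \<union> (?K \<union> ?N))" by auto
  moreover have "card (?I \<union> (?J \<union> (?K \<union> ?N))) = card ?I + card (?J \<union> (?K \<union> ?N))"
    using assms by (intro card_Un_disjoint) auto
  moreover have "card (?J \<union> (?K \<union> ?N)) = card ?J + card (?K \<union> ?N)"
    using assms by (intro card_Un_disjoint) auto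
  moreover have "card (?K \<union> ?N) = card ?K + card ?N"
    using assms by (intro card_Un_disjoint) auto
  moreover have "card ?J = card {a \<in> A. a < v}" "card ?K = card {b \<in> B. w < b}"
    by (simp_all add: card_image inj_on_def)
  ultimately show ?thesis by simp
qed

lemma card_split_around:
  fixes B :: "'a::linorder set"
  assumes "finite B" "w \<notin> B"
  shows "card {b \<in> B. b < w} + card {b \<in> B. w < b} = card B"
proof -
  have "card {b \<in> B. b < w} + card {b \<in> B. w < b} = card ({b \<in> B. b < w} \<union> {b \<in> B. w < b})"
    using assms by (intro card_Un_disjoint[symmetric]) auto
  also have "{b \<in> B. b < w} \<union> {b \<in> B. w < b} = B" using assms(2) by (auto, metis neq_iff)
  finally show ?thesis .
qed

text \<open>The terms that remove both spins from the same vertex vanish, which leaves the two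
  exchange terms.\<close>

lemma vann_vann_apply:
  assumes "double_free \<phi>" "v \<noteq> w"
  shows "vann {v, w} False (vann {v, w} True \<phi>) T
    = ann (Vtx v, False) (ann (Vtx w, True) \<phi>) T + ann (Vtx w, False) (ann (Vtx v, True) \<phi>) T"
proof -
  have "ann (Vtx x, False) (ann (Vtx x, True) \<phi>) T = 0" for x
    using assms(1) by (auto simp: ann_def intro: double_freeD)
  then show ?thesis using assms(2) by (simp add: vann_def ann_sum ann_add)
qed

text \<open>The exponent adds the two Jordan-Wigner signs and the inversion count after
  \<open>w\<close> has joined the up spins and \<open>v\<close> the down spins. It stays
  unsimplified: only its parity relative to the version with \<open>v\<close> and \<open>w\<close>
  exchanged matters.\<close>

lemma ann_pair_gauged:
  assumes fin: "finite X" and A: "A \<subseteq> X" and vw: "v \<notin> X" "w \<notin> X" "v \<noteq> w"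
  shows "ann (Vtx v, False) (ann (Vtx w, True) \<phi>) (spin_config X A)
    = (-1) ^ (card {a \<in> X - A. a < v} + (Suc (card (X - A)) + card {a \<in> A. a < w})
        + (card {p \<in> A \<times> (X - A). fst p < snd p} + card {a \<in> A. a < v} + card {b \<in> X - A. w < b}
        + (if w < v then 1 else 0)))
      * gauged \<phi> (insert v (insert w X)) (insert w A)"
proof -
  let ?T = "spin_config X A" and ?Y = "insert v (insert w X)"
  have finA: "finite A" using fin A finite_subset by blast
  have vA: "v \<notin> A" "w \<notin> A" using A vw by auto
  have T1: "insert (Vtx v, False) ?T = spin_config (insert v X) A"
    using spin_config_insert_down[OF vw(1) A] .
  have T2: "insert (Vtx w, True) (spin_config (insert v X) A) = spin_config ?Y (insert w A)"
    using spin_config_insert_up[of w "insert v X" A] vw by (simp add: insert_commute)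
  have d1: "insert v X - A = insert v (X - A)" using vA by auto
  have d2: "?Y - insert w A = insert v (X - A)" using vA vw by auto
  have s1: "jw_sign (Vtx v, False) ?T = (-1) ^ card {a \<in> X - A. a < v}" by (rule jw_sign_down)
  have "jw_sign (Vtx w, True) (spin_config (insert v X) A)
      = (-1) ^ (card (insert v X - A) + card {a \<in> A. a < w})"
    by (rule jw_sign_up) (use fin A in auto)
  then have s2: "jw_sign (Vtx w, True) (spin_config (insert v X) A) = (-1) ^ (Suc (card (X - A)) + card {a \<in> A. a < w})"
    using fin vw by (simp add: d1)
  have s3: "\<phi> (spin_config ?Y (insert w A))
      = (-1) ^ (card {p \<in> A \<times> (X - A). fst p < snd p} + card {a \<in> A. a < v} + card {b \<in> X - A. w < b}
        + (if w < v then 1 else 0)) * gauged \<phi> ?Y (insert w A)"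
    unfolding gauged_inverse[of \<phi> ?Y "insert w A"] d2 gauge_sign_def
    using card_inversions_insert[of A "X - A" w v] fin finA vA vw by simp
  have "ann (Vtx v, False) (ann (Vtx w, True) \<phi>) ?T
      = jw_sign (Vtx v, False) ?T * (jw_sign (Vtx w, True) (spin_config (insert v X) A)
        * \<phi> (spin_config ?Y (insert w A)))"
    using vw vA by (simp add: ann_def T1 T2)
  then show ?thesis unfolding s1 s2 s3 by (simp only: power_add mult_ac)
qed

text \<open>After gauging, the two exchange terms carry opposite signs whatever the other spins are,
  so they cancel exactly when the two amplitudes agree.\<close>

lemma vann_vann_eq_0_iff:
  assumes df: "double_free \<phi>" and fin: "finite X" and A: "A \<subseteq> X" and vw: "v \<notin> X" "w \<notin> X" "v \<noteq> w"
  shows "vann {v, w} False (vann {v, w} True \<phi>) (spin_config X A) = 0 \<longleftrightarrow>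
    gauged \<phi> (insert v (insert w X)) (insert v A) = gauged \<phi> (insert v (insert w X)) (insert w A)"
proof -
  define B where "B = X - A"
  have finB: "finite B" "v \<notin> B" "w \<notin> B" using fin vw by (auto simp: B_def)
  define e1 where "e1 = card {a \<in> B. a < v} + (Suc (card B) + card {a \<in> A. a < w})
        + (card {p \<in> A \<times> B. fst p < snd p} + card {a \<in> A. a < v} + card {b \<in> B. w < b}
        + (if w < v then 1 else 0))"
  define e2 where "e2 = card {a \<in> B. a < w} + (Suc (card B) + card {a \<in> A. a < v})
        + (card {p \<in> A \<times> B. fst p < snd p} + card {a \<in> A. a < w} + card {b \<in> B. v < b}
        + (if v < w then 1 else 0))"
  have "even e1 \<longleftrightarrow> odd e2"
  proof -
    have 1: "card {b \<in> B. b < v} + card {b \<in> B. v < b} = card B"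
      "card {b \<in> B. b < w} + card {b \<in> B. w < b} = card B"
      using card_split_around finB by blast+
    have "w < v \<longleftrightarrow> \<not> v < w" using vw(3) by auto
    then have 2: "(if w < v then 1 else 0) + (if v < w then 1 else 0) = (1 :: nat)" by simp
    \<comment> \<open>For each of the two sites, the down spins below and above it add up to
      \<open>card B\<close>; together with exactly one of w < v and v < w this makes the sum
      odd.\<close>
    have "e1 + e2 = 2 * (Suc (card B) + card {a \<in> A. a < w} + card {p \<in> A \<times> B. fst p < snd p}
        + card {a \<in> A. a < v} + card B) + 1"
      unfolding e1_def e2_def using 1 2 by (simp split del: if_split)
    then have "odd (e1 + e2)" by simp
    then show ?thesis by simp
  qed
  then have s: "(-1 :: complex) ^ e1 = - ((-1) ^ e2)" by (simp add: minus_one_power_iff)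
  have t1: "ann (Vtx v, False) (ann (Vtx w, True) \<phi>) (spin_config X A)
      = (-1) ^ e1 * gauged \<phi> (insert v (insert w X)) (insert w A)"
    using ann_pair_gauged[OF fin A vw] unfolding e1_def B_def .
  have t2: "ann (Vtx w, False) (ann (Vtx v, True) \<phi>) (spin_config X A)
      = (-1) ^ e2 * gauged \<phi> (insert v (insert w X)) (insert v A)"
    using ann_pair_gauged[OF fin A vw(2,1) vw(3)[symmetric]] unfolding e2_def B_def
    by (simp add: insert_commute)
  show ?thesis unfolding vann_vann_apply[OF df vw(3)] t1 t2 s
    by (simp add: minus_one_power_iff)
qed

text \<open>Spin configurations avoiding both sites are settled by the exchange hypothesis; from any
  other configuration, adding the two spins cannot reach the support of
  \<open>\<phi>\<close>.\<close>

lemma vann_vann_eq_0: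
  assumes df: "double_free \<phi>" and vw: "v \<noteq> w"
    and sup: "\<And>T. \<phi> T \<noteq> 0 \<Longrightarrow> \<exists>X A. finite X \<and> A \<subseteq> X \<and> T = spin_config X A"
    and sw: "\<And>X A. finite X \<Longrightarrow> A \<subseteq> X \<Longrightarrow> v \<notin> X \<Longrightarrow> w \<notin> X \<Longrightarrow>
      gauged \<phi> (insert v (insert w X)) (insert v A) = gauged \<phi> (insert v (insert w X)) (insert w A)"
  shows "vann {v, w} False (vann {v, w} True \<phi>) = (\<lambda>T. 0)"
proof
  fix T
  show "vann {v, w} False (vann {v, w} True \<phi>) T = 0"
  proof (cases "\<exists>X A. finite X \<and> A \<subseteq> X \<and> v \<notin> X \<and> w \<notin> X \<and> T = spin_config X A")
    case True
    then obtain X A where XA: "finite X" "A \<subseteq> X" "v \<notin> X" "w \<notin> X" "T = spin_config X A" by blast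
    then show ?thesis using vann_vann_eq_0_iff[OF df XA(1-4) vw] sw[OF XA(1-4)] by simp
  next
    case False
    have "ann (Vtx x, False) (ann (Vtx y, True) \<phi>) T = 0" if xy: "{x, y} = {v, w}" "x \<noteq> y" for x y
    proof (rule ccontr)
      assume nz: "ann (Vtx x, False) (ann (Vtx y, True) \<phi>) T \<noteq> 0"
      then have nin: "(Vtx x, False) \<notin> T" "(Vtx y, True) \<notin> T"
        and p: "\<phi> (insert (Vtx y, True) (insert (Vtx x, False) T)) \<noteq> 0"
        by (auto simp: ann_def split: if_splits)
      obtain X A where XA: "finite X" "A \<subseteq> X" "insert (Vtx y, True) (insert (Vtx x, False) T) = spin_config X A"
        using sup[OF p] by blast
      have "(Vtx y, True) \<in> spin_config X A" "(Vtx x, False) \<in> spin_config X A"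
        unfolding XA(3)[symmetric] by auto
      then have y: "y \<in> A" and x: "x \<in> X" "x \<notin> A" by auto
      \<comment> \<open>Removing the two added spins from a configuration in the support exhibits
        \<open>T\<close> as a spin configuration avoiding both sites, contrary to the case.\<close>
      have "T = spin_config X A - {(Vtx y, True), (Vtx x, False)}" using nin unfolding XA(3)[symmetric] by auto
      also have "\<dots> = spin_config (X - {x, y}) (A - {y})" using x y XA(2) by (auto simp: spin_config_def)
      finally have "T = spin_config (X - {x, y}) (A - {y})" .
      moreover have "finite (X - {x, y})" "A - {y} \<subseteq> X - {x, y}" using XA x by auto
      moreover have "v \<notin> X - {x, y}" "w \<notin> X - {x, y}" using xy by blast+
      ultimately have "\<exists>X A. finite X \<and> A \<subseteq> X \<and> v \<notin> X \<and> w \<notin> X \<and> T = spin_config X A"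
        by (intro exI[of _ "X - {x, y}"] exI[of _ "A - {y}"] conjI)
      then show False using False by contradiction
    qed
    from this[of v w] this[of w v] show ?thesis
      unfolding vann_vann_apply[OF df vw] using vw by (simp add: insert_commute)
  qed
qed

text \<open>In gauged amplitudes this is the indicator of one exchange class. \<open>ups\<close>
  recovers the up set from \<open>T\<close>, which avoids an existential over it.\<close>

definition class_vec :: "nat \<Rightarrow> nat \<Rightarrow> nat list set \<times> (nat list \<Rightarrow> nat) \<Rightarrow> fvec" where
  "class_vec d L i T =
     (if T = spin_config (fst i) (ups T) \<and> ups T \<subseteq> fst i \<and> upkey (lat_adj d L) (fst i) (ups T) = snd i
      then gauge_sign (ups T) (fst i - ups T) else 0)"

lemma gauged_class_vec:
  assumes "A \<subseteq> Y"
  shows "gauged (class_vec d L (X, h)) Y A = (if Y = X \<and> upkey (lat_adj d L) X A = h then 1 else 0)"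
proof (cases "Y = X")
  case True
  then show ?thesis using assms by (simp add: gauged_def class_vec_def)
next
  case False
  have "\<not> (spin_config Y A = spin_config X A \<and> A \<subseteq> X)"
    using spin_config_inject[OF assms] False by blast
  then show ?thesis using False by (auto simp: gauged_def class_vec_def)
qed

lemma class_vec_supp:
  "class_vec d L (X, h) T \<noteq> 0 \<Longrightarrow> \<exists>A\<subseteq>X. T = spin_config X A"
  by (auto simp: class_vec_def split: if_splits)

lemma double_free_class_vec: "double_free (class_vec d L (X, h))"
  unfolding double_free_def
proof (intro allI impI)
  fix s :: site and T :: "mode set" assume sT: "(s, True) \<in> T \<and> (s, False) \<in> T"
  show "class_vec d L (X, h) T = 0"
  proof (rule ccontr)
    assume "class_vec d L (X, h) T \<noteq> 0"
    then obtain A where "T = spin_config X A" using class_vec_supp by blast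
    then show False using sT by (cases s) auto
  qed
qed

lemma fock_class_vec: "X \<subseteq> lat_V d L \<Longrightarrow> class_vec d L (X, h) \<in> fock d L"
  unfolding fock_def using class_vec_supp spin_config_subset by blast

text \<open>Exchanging the spins at the ends of an edge preserves the key, so the class indicator
  takes equal values on both sides of the exchange relation.\<close>

lemma vann_vann_class_vec:
  assumes b: "b \<in> lat_B d L" and L: "2 \<le> L" and X: "X \<subseteq> lat_V d L"
  shows "vann b False (vann b True (class_vec d L (X, h))) = (\<lambda>T. 0)"
proof -
  let ?E = "lat_adj d L"
  obtain v w where vw: "b = {v, w}" "v \<in> lat_V d L" "w \<in> lat_V d L" "?E v w" using b by (auto simp: lat_B_def)
  have neq: "v \<noteq> w" using lat_adj_neq[OF vw(2) L vw(4)] .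
  have finX: "finite X" using X by (rule finite_subset) simp
  show ?thesis unfolding vw(1)
  proof (rule vann_vann_eq_0[OF double_free_class_vec neq])
    fix T assume "class_vec d L (X, h) T \<noteq> 0"
    then obtain A where "A \<subseteq> X" "T = spin_config X A" using class_vec_supp[of d L X h T] by auto
    then show "\<exists>X A. finite X \<and> A \<subseteq> X \<and> T = spin_config X A"
      using finX by (intro exI[of _ X] exI[of _ A] conjI)
  next
    fix Y A assume Y: "finite Y" "A \<subseteq> Y" "v \<notin> Y" "w \<notin> Y"
    let ?Y = "insert v (insert w Y)"
    have "(insert v A, insert w (insert v A - {v})) \<in> swaps ?E ?Y"
      by (rule swapsI) (use Y neq vw in auto)
    moreover have "insert w (insert v A - {v}) = insert w A" using Y by auto
    ultimately have "upkey ?E ?Y (insert w A) = upkey ?E ?Y (insert v A)"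
      using upkey_swap[OF symp_lat_adj, of ?Y "insert v A" "insert w A"] Y by simp
    moreover have "insert v A \<subseteq> ?Y" "insert w A \<subseteq> ?Y" using Y by auto
    ultimately show "gauged (class_vec d L (X, h)) ?Y (insert v A) = gauged (class_vec d L (X, h)) ?Y (insert w A)"
      using gauged_class_vec[of "insert v A" ?Y d L X h] gauged_class_vec[of "insert w A" ?Y d L X h]
      by (cases "?Y = X") simp_all
  qed
qed

text \<open>Equal keys are linked by a chain of elementary exchanges, and each exchange is the
  equation of its bond read at the configuration with both ends removed.\<close>

lemma gauged_upkey_invariant:
  assumes df: "double_free \<psi>" and L: "2 \<le> L" and X: "X \<subseteq> lat_V d L"
    and z: "\<And>b. b \<in> lat_B d L \<Longrightarrow> vann b False (vann b True \<psi>) = (\<lambda>T. 0)"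
    and A: "A \<subseteq> X" "A' \<subseteq> X" "upkey (lat_adj d L) X A = upkey (lat_adj d L) X A'"
  shows "gauged \<psi> X A = gauged \<psi> X A'"
proof -
  let ?E = "lat_adj d L"
  have finX: "finite X" using X by (rule finite_subset) simp
  have "(A, A') \<in> (swaps ?E X)\<^sup>*" by (rule upkey_eq_imp_swaps[OF symp_lat_adj finX A])
  then show ?thesis
  proof (induction rule: rtrancl_induct)
    case (step C D)
    obtain v w where vw: "D = insert w (C - {v})" "C \<subseteq> X" "v \<in> C" "w \<in> X" "w \<notin> C" "?E v w"
      using step(2) by (auto simp: swaps_def)
    have V: "v \<in> lat_V d L" "w \<in> lat_V d L" using vw X by auto
    have b: "{v, w} \<in> lat_B d L" using V vw(6) by (auto simp: lat_B_def)
    have e: "insert v (insert w (X - {v, w})) = X" "insert v (C - {v}) = C" using vw by auto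
    have "gauged \<psi> (insert v (insert w (X - {v, w}))) (insert v (C - {v}))
        = gauged \<psi> (insert v (insert w (X - {v, w}))) (insert w (C - {v}))"
      using fun_cong[OF z[OF b], of "spin_config (X - {v, w}) (C - {v})"]
      by (subst (asm) vann_vann_eq_0_iff[OF df]) (use vw finX in auto)
    then have "gauged \<psi> X C = gauged \<psi> X D" unfolding e vw(1) .
    then show ?case using step by simp
  qed simp
qed

subsection \<open>Trace formula and density bounds\<close>

text \<open>A Gram-Schmidt step: \<open>\<psi>\<close> and \<open>b j\<close> are both corrected by
  the earlier vectors, then the residual of \<open>\<psi>\<close> is corrected by the residual of
  \<open>b j\<close>.\<close>

lemma orthogonal_projection_coeffs:
  assumes "finite I"
  shows "\<exists>c. \<forall>j\<in>I. finner M (b j) (\<lambda>T. \<psi> T - (\<Sum>i\<in>I. c i * b i T)) = 0"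
  using assms
proof (induction I arbitrary: \<psi> rule: finite_induct)
  case (insert j I)
  obtain e where e: "\<And>k. k \<in> I \<Longrightarrow> finner M (b k) (\<lambda>T. b j T - (\<Sum>i\<in>I. e i * b i T)) = 0"
    using insert.IH[of "b j"] by blast
  obtain c where c: "\<And>k. k \<in> I \<Longrightarrow> finner M (b k) (\<lambda>T. \<psi> T - (\<Sum>i\<in>I. c i * b i T)) = 0"
    using insert.IH[of \<psi>] by blast
  define r where "r = (\<lambda>T. b j T - (\<Sum>i\<in>I. e i * b i T))"
  define s where "s = (\<lambda>T. \<psi> T - (\<Sum>i\<in>I. c i * b i T))"
  \<comment> \<open>If the residual \<open>r\<close> has norm zero, division by zero makes
    \<open>\<alpha>\<close> zero; \<open>finner M r s\<close> vanishes as well, so orthogonality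
    persists.\<close>
  define \<alpha> where "\<alpha> = finner M r s / finner M r r"
  define s' where "s' = (\<lambda>T. s T + (- \<alpha>) * r T)"
  define c' where "c' i = (if i = j then \<alpha> else c i - \<alpha> * e i)" for i
  have res: "(\<lambda>T. \<psi> T - (\<Sum>i\<in>insert j I. c' i * b i T)) = s'"
  proof
    fix T
    have "(\<Sum>i\<in>I. c' i * b i T) = (\<Sum>i\<in>I. c i * b i T - \<alpha> * (e i * b i T))"
      by (rule sum.cong) (use insert.hyps in \<open>auto simp: c'_def algebra_simps\<close>)
    also have "\<dots> = (\<Sum>i\<in>I. c i * b i T) - \<alpha> * (\<Sum>i\<in>I. e i * b i T)"
      by (simp add: sum_subtractf sum_distrib_left)
    finally show "\<psi> T - (\<Sum>i\<in>insert j I. c' i * b i T) = s' T"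
      using insert.hyps by (simp add: s'_def s_def r_def c'_def algebra_simps)
  qed
  have oI: "finner M (b k) s' = 0" if "k \<in> I" for k
    unfolding s'_def finner_add_right finner_scale_right using e[OF that] c[OF that] by (simp add: r_def s_def)
  have "finner M r r = 0 \<Longrightarrow> finner M r s = 0"
  proof -
    assume z: "finner M r r = 0"
    show "finner M r s = 0"
    proof (cases "finite M")
      case True
      have "(\<Sum>T\<in>Pow M. (cmod (r T))\<^sup>2) = 0" using z unfolding finner_self by (simp only: of_real_eq_0_iff)
      then have "\<forall>T\<in>Pow M. (cmod (r T))\<^sup>2 = 0" using True by (subst (asm) sum_nonneg_eq_0_iff) auto
      then show ?thesis by (simp add: finner_def)
    qed (simp add: finner_def)
  qed
  then have r0: "finner M r s' = 0"
    unfolding s'_def finner_add_right finner_scale_right \<alpha>_def by auto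
  have "finner M (b j) s' = finner M (\<lambda>T. r T + (\<Sum>i\<in>I. e i * b i T)) s'" by (simp add: r_def)
  also have "\<dots> = cnj (finner M s' (\<lambda>T. r T + (\<Sum>i\<in>I. e i * b i T)))" by (rule finner_cnj)
  also have "\<dots> = finner M r s' + (\<Sum>i\<in>I. cnj (e i) * finner M (b i) s')"
    unfolding finner_add_right finner_sum_right finner_scale_right by (simp add: finner_cnj[of M _ s'])
  also have "\<dots> = 0" using r0 oI by simp
  finally have "\<forall>k\<in>insert j I. finner M (b k) s' = 0" using oI by simp
  then show ?case unfolding res[symmetric] by blast
qed simp

section \<open>Basis vectors indexed by spin classes, and dual coordinates\<close>

definition mid_list :: "nat \<Rightarrow> nat \<Rightarrow> (nat list set \<times> bool) list" where
  "mid_list d L = (SOME ps. set ps = lat_B d L \<times> UNIV \<and> distinct ps)"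

lemma mid_list: "set (mid_list d L) = lat_B d L \<times> UNIV \<and> distinct (mid_list d L)"
  unfolding mid_list_def by (rule someI_ex) (rule finite_distinct_list, simp)

definition spin_classes :: "nat \<Rightarrow> nat \<Rightarrow> (nat list set \<times> (nat list \<Rightarrow> nat)) set" where
  "spin_classes d L = (SIGMA X:Pow (lat_V d L). upkey (lat_adj d L) X ` Pow X)"

lemma spin_classes_subset: "i \<in> spin_classes d L \<Longrightarrow> fst i \<subseteq> lat_V d L"
  by (auto simp: spin_classes_def)

lemma finite_lat_subset: "X \<subseteq> lat_V d L \<Longrightarrow> finite X"
  by (erule finite_subset) simp

lemma finite_spin_classes [simp]: "finite (spin_classes d L)"
  unfolding spin_classes_def using finite_lat_subset by (intro finite_SigmaI) auto

lemma sum_spin_classes: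
  fixes f :: "nat \<Rightarrow> 'b::comm_ring_1"
  shows "(\<Sum>i\<in>spin_classes d L. f (card (fst i)))
    = (\<Sum>X\<in>Pow (lat_V d L). of_nat (spin_mult (lat_adj d L) X) * f (card X))"
proof -
  have "(\<Sum>i\<in>spin_classes d L. f (card (fst i)))
      = (\<Sum>X\<in>Pow (lat_V d L). \<Sum>h\<in>upkey (lat_adj d L) X ` Pow X. f (card X))"
    unfolding spin_classes_def using finite_lat_subset
    by (subst sum.Sigma) (auto simp: split_beta)
  then show ?thesis by (simp add: spin_mult_def)
qed

definition ground_vec :: "nat \<Rightarrow> nat \<Rightarrow> real \<Rightarrow> nat list set \<times> (nat list \<Rightarrow> nat) \<Rightarrow> fvec" where
  "ground_vec d L lam i = ext_mid lam (mid_list d L) (class_vec d L i)"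

definition class_rep :: "nat \<Rightarrow> nat \<Rightarrow> nat list set \<times> (nat list \<Rightarrow> nat) \<Rightarrow> nat list set" where
  "class_rep d L i = (SOME A. A \<subseteq> fst i \<and> upkey (lat_adj d L) (fst i) A = snd i)"

text \<open>Reads the amplitude at one representative of the class. These functionals are dual to
  the family \<open>ground_vec\<close>, which is not orthogonal in general.\<close>

definition coord :: "nat \<Rightarrow> nat \<Rightarrow> nat list set \<times> (nat list \<Rightarrow> nat) \<Rightarrow> fvec \<Rightarrow> complex" where
  "coord d L i \<psi> = gauged \<psi> (fst i) (class_rep d L i)"

lemma class_rep:
  assumes "i \<in> spin_classes d L"
  shows "class_rep d L i \<subseteq> fst i \<and> upkey (lat_adj d L) (fst i) (class_rep d L i) = snd i"
proof -
  have "\<exists>A. A \<subseteq> fst i \<and> upkey (lat_adj d L) (fst i) A = snd i"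
    using assms by (auto simp: spin_classes_def) blast
  then show ?thesis unfolding class_rep_def by (rule someI_ex)
qed

lemma coord_sum: "coord d L i (\<lambda>T. \<Sum>j\<in>J. c j * f j T) = (\<Sum>j\<in>J. c j * coord d L i (f j))"
  unfolding coord_def gauged_def by (simp add: sum_distrib_left mult_ac)

lemma ground_vec_vertex: "ground_vec d L lam i (spin_config X A) = class_vec d L i (spin_config X A)"
  unfolding ground_vec_def by (rule ext_mid_vertex) simp

lemma gauged_ground_vec:
  assumes "A \<subseteq> Y"
  shows "gauged (ground_vec d L lam i) Y A
    = (if Y = fst i \<and> upkey (lat_adj d L) (fst i) A = snd i then 1 else 0)"
  using gauged_class_vec[OF assms, of d L "fst i" "snd i"] by (simp add: gauged_def ground_vec_vertex)

lemma coord_ground_vec: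
  assumes "i \<in> spin_classes d L"
  shows "coord d L i (ground_vec d L lam j) = (if i = j then 1 else 0)"
  unfolding coord_def using class_rep[OF assms] by (auto simp: gauged_ground_vec prod_eq_iff)

lemma ground_vec_card:
  assumes i: "fst i \<subseteq> lat_V d L" and T: "T \<subseteq> modes d L" "card T \<noteq> card (fst i)"
  shows "ground_vec d L lam i T = 0"
  unfolding ground_vec_def
proof (rule ext_mid_card[OF _ _ T])
  fix S assume S: "S \<subseteq> modes d L" "card S \<noteq> card (fst i)"
  show "class_vec d L i S = 0"
  proof (rule ccontr)
    assume "class_vec d L i S \<noteq> 0"
    then obtain A where "A \<subseteq> fst i" "S = spin_config (fst i) A"
      using class_vec_supp[of d L "fst i" "snd i" S] by auto
    then show False using card_spin_config[OF finite_lat_subset[OF i]] S by simp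
  qed
qed (use mid_list in auto)

section \<open>Ground-space basis, projection and trace\<close>

locale decorated_model =
  fixes d L :: nat and t lam U U' :: real
  assumes two_le_L: "2 \<le> L" and t_pos: "0 < t" and lam_pos: "0 < lam" and U_pos: "0 < U" "0 < U'"
begin

abbreviation "G \<equiv> ground_space d L t lam U U'"
abbreviation "M \<equiv> modes d L"
abbreviation "P \<equiv> P0 d L t lam U U'"
abbreviation "bv \<equiv> ground_vec d L lam"
abbreviation "cls \<equiv> spin_classes d L"

lemma G_iff: "\<psi> \<in> G \<longleftrightarrow> \<psi> \<in> fock d L \<and> (\<forall>b\<in>lat_B d L. \<forall>\<sigma>. bond_ann lam \<sigma> b \<psi> = (\<lambda>_. 0)) \<and> double_free \<psi>"
  by (rule ground_space_iff[OF t_pos U_pos])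

lemma G_add:
  assumes "\<phi> \<in> G" "\<psi> \<in> G" shows "(\<lambda>T. \<phi> T + \<psi> T) \<in> G"
proof -
  have "bond_ann lam \<sigma> b (\<lambda>T. \<phi> T + \<psi> T) = (\<lambda>T. bond_ann lam \<sigma> b \<phi> T + bond_ann lam \<sigma> b \<psi> T)" for \<sigma> b
    unfolding bond_ann_vann vann_add ann_add by (simp add: algebra_simps)
  then show ?thesis using assms by (auto simp: G_iff double_free_def intro: fock_add)
qed

lemma G_scale:
  assumes "\<psi> \<in> G" shows "(\<lambda>T. c * \<psi> T) \<in> G"
proof -
  have "bond_ann lam \<sigma> b (\<lambda>T. c * \<psi> T) = (\<lambda>T. c * bond_ann lam \<sigma> b \<psi> T)" for \<sigma> b
    unfolding bond_ann_vann vann_scale ann_scale by (simp add: algebra_simps)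
  then show ?thesis using assms by (auto simp: G_iff double_free_def intro: fock_scale)
qed

lemma G_diff:
  assumes "\<phi> \<in> G" "\<psi> \<in> G" shows "(\<lambda>T. \<phi> T - \<psi> T) \<in> G"
  using G_add[OF assms(1) G_scale[OF assms(2), of "-1"]] by simp

lemma G_zero: "(\<lambda>T. 0) \<in> G"
  by (auto simp: G_iff double_free_def fock_def bond_ann_vann vann_zero ann_zero)

lemma G_sum:
  assumes "finite I" "\<And>i. i \<in> I \<Longrightarrow> f i \<in> G" shows "(\<lambda>T. \<Sum>i\<in>I. c i * f i T) \<in> G"
  using assms
proof (induction I rule: finite_induct)
  case empty then show ?case using G_zero by simp
next
  case (insert j I)
  then show ?case using G_add[OF G_scale[of "f j" "c j"], of "\<lambda>T. \<Sum>i\<in>I. c i * f i T"] by simp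
qed

lemma vann_vann_G:
  assumes \<psi>: "\<psi> \<in> G" and b: "b \<in> lat_B d L"
  shows "vann b False (vann b True \<psi>) = (\<lambda>T. 0)"
proof
  fix T
  have "ann (Mid b, True) (ann (Mid b, False) \<psi>) = (\<lambda>T. 0)"
    using \<psi> by (subst double_occupied_iff[symmetric]) (auto simp: G_iff double_free_def)
  moreover have "ann (Mid b, True) (ann (Mid b, False) \<psi>)
    = (\<lambda>T. - (1 / of_real lam) * ((1 / of_real lam) * vann b False (vann b True \<psi>) T))"
    by (rule ann_Mid_pair[OF _ b two_le_L]) (use \<psi> b lam_pos in \<open>auto simp: G_iff\<close>)
  ultimately have "- (1 / of_real lam) * ((1 / of_real lam) * vann b False (vann b True \<psi>) T) = 0"
    by metis
  then show "vann b False (vann b True \<psi>) T = 0" using lam_pos by simp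
qed

text \<open>Vertex annihilators and \<open>vann\<close> commute through the extension, so both kinds
  of double occupancy reduce to facts about \<open>class_vec\<close>: directly at a vertex, and
  through the bond equation at a midpoint.\<close>

lemma bv_G:
  assumes i: "fst i \<subseteq> lat_V d L" shows "bv i \<in> G"
proof -
  let ?ps = "mid_list d L" and ?g = "class_vec d L i"
  have ps: "set ?ps \<subseteq> lat_B d L \<times> UNIV" using mid_list by blast
  have g: "?g \<in> fock d L" using fock_class_vec[OF i, of "snd i"] by simp
  have df: "double_free ?g" using double_free_class_vec[of d L "fst i" "snd i"] by simp
  have f: "bv i \<in> fock d L" unfolding ground_vec_def by (rule fock_ext_mid[OF g ps])
  have z: "bond_ann lam \<sigma> b (bv i) = (\<lambda>T. 0)" if b: "b \<in> lat_B d L" for \<sigma> b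
    unfolding ground_vec_def
  proof (rule bond_ann_ext_mid[OF g two_le_L _ b _ ps])
    show "ann (Mid b, \<sigma>) ?g = (\<lambda>T. 0)"
    proof
      fix T
      have "?g (insert (Mid b, \<sigma>) T) = 0"
      proof (rule ccontr)
        assume "?g (insert (Mid b, \<sigma>) T) \<noteq> 0"
        then obtain A where "insert (Mid b, \<sigma>) T = spin_config (fst i) A"
          using class_vec_supp[of d L "fst i" "snd i" "insert (Mid b, \<sigma>) T"] by auto
        then show False by (metis insertI1 mem_spin_config(3))
      qed
      then show "ann (Mid b, \<sigma>) ?g T = 0" by (simp add: ann_def)
    qed
  qed (use lam_pos mid_list b in auto)
  have "double_free (bv i)" unfolding double_free_def
  proof (intro allI impI)
    fix s :: site and T :: "mode set" assume sT: "(s, True) \<in> T \<and> (s, False) \<in> T"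
    show "bv i T = 0"
    proof (cases "T \<subseteq> M")
      case True
      then have "s \<in> lat_Lambda d L" using sT by (auto simp: modes_def)
      then have "ann (s, True) (ann (s, False) (bv i)) = (\<lambda>T. 0)"
        unfolding lat_Lambda_def
      proof (elim UnE imageE)
        fix u assume u: "s = Vtx u" "u \<in> lat_V d L"
        have c: "ann (s, \<sigma>) (ext_mid lam ?ps h) = ext_mid lam ?ps (ann (s, \<sigma>) h)" if "h \<in> fock d L" for h \<sigma>
          by (rule ann_ext_mid[OF that _ two_le_L ps]) (use u Vtx_mode in auto)
        have "ann (s, True) (ann (s, False) (bv i)) = ext_mid lam ?ps (ann (s, True) (ann (s, False) ?g))"
          unfolding ground_vec_def by (simp add: c g fock_ann)
        also have "ann (s, True) (ann (s, False) ?g) = (\<lambda>T. 0)"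
          using df by (subst double_occupied_iff[symmetric]) (auto simp: double_free_def)
        finally show ?thesis by (simp add: ext_mid_zero)
      next
        fix b assume b: "s = Mid b" "b \<in> lat_B d L"
        have c: "vann b \<sigma> (ext_mid lam ?ps h) = ext_mid lam ?ps (vann b \<sigma> h)" if "h \<in> fock d L" for h \<sigma>
          by (rule vann_ext_mid[OF that b(2) two_le_L ps])
        have "vann b False (vann b True (bv i)) = ext_mid lam ?ps (vann b False (vann b True ?g))"
          unfolding ground_vec_def by (simp add: c g fock_vann)
        also have "vann b False (vann b True ?g) = (\<lambda>T. 0)"
          using vann_vann_class_vec[OF b(2) two_le_L i, of "snd i"] by simp
        finally have v: "vann b False (vann b True (bv i)) = (\<lambda>T. 0)" by (simp add: ext_mid_zero)
        have "ann (Mid b, True) (ann (Mid b, False) (bv i))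
          = (\<lambda>T. - (1 / of_real lam) * ((1 / of_real lam) * vann b False (vann b True (bv i)) T))"
          by (rule ann_Mid_pair[OF f b(2) two_le_L]) (use z b lam_pos in auto)
        then show ?thesis using v b by simp
      qed
      then show ?thesis using double_occupied_iff[of s "bv i"] sT by blast
    qed (rule fockD[OF f])
  qed
  then show ?thesis using f z by (auto simp: G_iff)
qed

text \<open>Induction on the number of occupied midpoint modes. The bond equation, read with one
  midpoint particle removed, expresses the amplitude through configurations in which that particle
  sits on a vertex. With no midpoints left, absence of double occupancy leaves only spin
  configurations.\<close>

lemma G_determined_by_vertices:
  assumes \<psi>: "\<psi> \<in> G" and v: "\<And>X A. X \<subseteq> lat_V d L \<Longrightarrow> A \<subseteq> X \<Longrightarrow> \<psi> (spin_config X A) = 0"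
  shows "\<psi> T = 0"
proof -
  have f: "\<psi> \<in> fock d L" and z: "\<And>b \<sigma>. b \<in> lat_B d L \<Longrightarrow> bond_ann lam \<sigma> b \<psi> = (\<lambda>_. 0)"
    and df: "double_free \<psi>" using \<psi> by (auto simp: G_iff)
  show ?thesis
  proof (cases "T \<subseteq> M")
    case True
    then show ?thesis
    proof (induction "card {p \<in> T. \<exists>b. fst p = Mid b}" arbitrary: T rule: less_induct)
      case less
      have finT: "finite T" using less.prems finite_subset finite_modes by blast
      show ?case
      proof (cases "\<exists>b \<sigma>. (Mid b, \<sigma>) \<in> T")
        case True
        then obtain b \<sigma> where bT: "(Mid b, \<sigma>) \<in> T" by blast
        then have b: "b \<in> lat_B d L" using less.prems by (auto simp: modes_def lat_Lambda_def)
        let ?T = "T - {(Mid b, \<sigma>)}"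
        have "ann (Vtx x, \<sigma>) \<psi> ?T = 0" if x: "x \<in> b" for x
        proof -
          have s: "insert (Vtx x, \<sigma>) ?T \<subseteq> M" using less.prems bond_vtx_mode[OF b x] by auto
          have "{p \<in> insert (Vtx x, \<sigma>) ?T. \<exists>b. fst p = Mid b} \<subseteq> {p \<in> T. \<exists>b. fst p = Mid b}"
            by auto
          moreover have "(Mid b, \<sigma>) \<in> {p \<in> T. \<exists>b. fst p = Mid b}" using bT by simp
          moreover have "(Mid b, \<sigma>) \<notin> {p \<in> insert (Vtx x, \<sigma>) ?T. \<exists>b. fst p = Mid b}" by simp
          ultimately have "{p \<in> insert (Vtx x, \<sigma>) ?T. \<exists>b. fst p = Mid b} \<subset> {p \<in> T. \<exists>b. fst p = Mid b}"
            by blast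
          then have "card {p \<in> insert (Vtx x, \<sigma>) ?T. \<exists>b. fst p = Mid b} < card {p \<in> T. \<exists>b. fst p = Mid b}"
            using finT by (intro psubset_card_mono) auto
          then have "\<psi> (insert (Vtx x, \<sigma>) ?T) = 0" using less.hyps s by blast
          then show ?thesis by (simp add: ann_def)
        qed
        then have "of_real lam * ann (Mid b, \<sigma>) \<psi> ?T = 0"
          using fun_cong[OF z[OF b, of \<sigma>], of ?T] by (simp add: bond_ann_apply)
        then show ?thesis using lam_pos bT by (simp add: ann_def insert_absorb)
      next
        case False
        show ?thesis
        proof (cases "\<exists>s. (s, True) \<in> T \<and> (s, False) \<in> T")
          case True then show ?thesis using df double_freeD by blast
        next
          case nd: False
          define A X where "A = {a. (Vtx a, True) \<in> T}" and "X = A \<union> {a. (Vtx a, False) \<in> T}"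
          have "p \<in> T \<longleftrightarrow> p \<in> spin_config X A" for p
          proof (cases p)
            case (Pair s \<sigma>)
            then show ?thesis using False nd by (cases s; cases \<sigma>) (auto simp: A_def X_def)
          qed
          then have "T = spin_config X A" by blast
          moreover have "X \<subseteq> lat_V d L" using less.prems by (auto simp: A_def X_def modes_def lat_Lambda_def)
          ultimately show ?thesis using v[of X A] by (simp add: X_def)
        qed
      qed
    qed
  qed (rule fockD[OF f])
qed

text \<open>Gauged amplitudes of a ground state are constant on classes, and the sum reproduces
  their values at the representatives; agreement on the vertices is enough.\<close>

lemma G_expand:
  assumes \<psi>: "\<psi> \<in> G"
  shows "\<psi> = (\<lambda>T. \<Sum>i\<in>cls. coord d L i \<psi> * bv i T)"
proof
  fix T
  let ?\<phi> = "\<lambda>T. \<Sum>i\<in>cls. coord d L i \<psi> * bv i T"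
  have \<phi>: "?\<phi> \<in> G" by (rule G_sum) (use bv_G spin_classes_subset in auto)
  have "(\<lambda>T. \<psi> T - ?\<phi> T) T = 0"
  proof (rule G_determined_by_vertices[OF G_diff[OF \<psi> \<phi>]])
    fix X A assume X: "X \<subseteq> lat_V d L" and A: "A \<subseteq> X"
    define i where "i = (X, upkey (lat_adj d L) X A)"
    have i: "i \<in> cls" using X A by (auto simp: i_def spin_classes_def)
    have "gauged \<psi> X A = gauged \<psi> X (class_rep d L i)"
      by (rule gauged_upkey_invariant[OF _ two_le_L X vann_vann_G[OF \<psi>] A])
         (use \<psi> class_rep[OF i] in \<open>auto simp: G_iff i_def\<close>)
    then have c: "gauged \<psi> X A = coord d L i \<psi>" by (simp add: coord_def i_def)
    have "gauged ?\<phi> X A = (\<Sum>j\<in>cls. coord d L j \<psi> * gauged (bv j) X A)"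
      unfolding gauged_def by (simp add: sum_distrib_left mult_ac)
    also have "\<dots> = (\<Sum>j\<in>cls. if j = i then coord d L j \<psi> else 0)"
      by (rule sum.cong) (auto simp: gauged_ground_vec[OF A] i_def)
    also have "\<dots> = coord d L i \<psi>" using i by simp
    finally have "gauged \<psi> X A = gauged ?\<phi> X A" using c by simp
    then show "\<psi> (spin_config X A) - ?\<phi> (spin_config X A) = 0"
      unfolding gauged_inverse[of \<psi>] gauged_inverse[of ?\<phi>] by simp
  qed
  then show "\<psi> T = ?\<phi> T" by simp
qed

text \<open>The difference of two candidates is a ground state orthogonal to itself. The description
  in \<open>P0\<close> has a usable value only once this and existence are known.\<close>

lemma P0_unique:
  assumes "\<phi> \<in> G" "\<phi>' \<in> G"
    "\<forall>\<chi>\<in>G. finner M \<chi> (\<lambda>T. \<psi> T - \<phi> T) = 0" "\<forall>\<chi>\<in>G. finner M \<chi> (\<lambda>T. \<psi> T - \<phi>' T) = 0"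
  shows "\<phi> = \<phi>'"
proof
  fix T
  let ?\<delta> = "\<lambda>T. \<phi> T - \<phi>' T"
  have \<delta>: "?\<delta> \<in> G" by (rule G_diff[OF assms(1,2)])
  have "finner M ?\<delta> ?\<delta> = finner M ?\<delta> (\<lambda>T. (\<psi> T - \<phi>' T) + (-1) * (\<psi> T - \<phi> T))" by simp
  also have "\<dots> = 0" unfolding finner_add_right finner_scale_right using assms(3,4) \<delta> by simp
  finally have "(\<Sum>T\<in>Pow M. (cmod (?\<delta> T))\<^sup>2) = 0" unfolding finner_self by (simp only: of_real_eq_0_iff)
  then have "\<forall>T\<in>Pow M. (cmod (?\<delta> T))\<^sup>2 = 0" by (subst (asm) sum_nonneg_eq_0_iff) auto
  then have "T \<subseteq> M \<Longrightarrow> ?\<delta> T = 0" by auto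
  moreover have "\<not> T \<subseteq> M \<Longrightarrow> ?\<delta> T = 0" using \<delta> by (intro fockD[of ?\<delta>]) (auto simp: G_iff)
  ultimately show "\<phi> T = \<phi>' T" by auto
qed

lemma P0_exists: "\<exists>\<phi>. \<phi> \<in> G \<and> (\<forall>\<chi>\<in>G. finner M \<chi> (\<lambda>T. \<psi> T - \<phi> T) = 0)"
proof -
  obtain c where c: "\<forall>j\<in>cls. finner M (bv j) (\<lambda>T. \<psi> T - (\<Sum>i\<in>cls. c i * bv i T)) = 0"
    using orthogonal_projection_coeffs[OF finite_spin_classes] by blast
  let ?\<phi> = "\<lambda>T. \<Sum>i\<in>cls. c i * bv i T" and ?r = "\<lambda>T. \<psi> T - (\<Sum>i\<in>cls. c i * bv i T)"
  have "?\<phi> \<in> G" by (rule G_sum) (use bv_G spin_classes_subset in auto)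
  moreover have "finner M \<chi> ?r = 0" if "\<chi> \<in> G" for \<chi>
  proof -
    have "finner M \<chi> ?r = finner M (\<lambda>T. \<Sum>i\<in>cls. coord d L i \<chi> * bv i T) ?r"
      using G_expand[OF that] by simp
    also have "\<dots> = cnj (finner M ?r (\<lambda>T. \<Sum>i\<in>cls. coord d L i \<chi> * bv i T))" by (rule finner_cnj)
    also have "\<dots> = (\<Sum>i\<in>cls. cnj (coord d L i \<chi>) * finner M (bv i) ?r)"
      unfolding finner_sum_right finner_scale_right by (simp add: finner_cnj[of M _ ?r])
    also have "\<dots> = 0" using c by simp
    finally show ?thesis .
  qed
  ultimately show ?thesis by blast
qed

lemma P0_eqI:
  assumes "\<phi> \<in> G" "\<forall>\<chi>\<in>G. finner M \<chi> (\<lambda>T. \<psi> T - \<phi> T) = 0"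
  shows "P \<psi> = \<phi>"
  unfolding P0_def
proof (rule the_equality)
  fix \<phi>' assume "\<phi>' \<in> G \<and> (\<forall>\<chi>\<in>G. finner M \<chi> (\<lambda>T. \<psi> T - \<phi>' T) = 0)"
  then show "\<phi>' = \<phi>" using P0_unique[of \<phi>' \<phi> \<psi>] assms by blast
qed (use assms in blast)

lemma P0_props: "P \<psi> \<in> G" "\<chi> \<in> G \<Longrightarrow> finner M \<chi> (\<lambda>T. \<psi> T - P \<psi> T) = 0"
proof -
  obtain \<phi> where \<phi>: "\<phi> \<in> G" "\<forall>\<chi>\<in>G. finner M \<chi> (\<lambda>T. \<psi> T - \<phi> T) = 0" using P0_exists by blast
  then have "P \<psi> = \<phi>" by (rule P0_eqI)
  then show "P \<psi> \<in> G" "\<chi> \<in> G \<Longrightarrow> finner M \<chi> (\<lambda>T. \<psi> T - P \<psi> T) = 0" using \<phi> by auto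
qed

text \<open>Supplies the instance of linearity of \<open>P0\<close> that the trace uses: the sum of
  projected kets and \<open>\<phi>\<close> itself both meet the characterisation of the projection
  of \<open>\<phi>\<close>.\<close>

lemma P0_ket_sum:
  assumes "\<phi> \<in> G"
  shows "(\<lambda>T. \<Sum>S\<in>Pow M. \<phi> S * P (ket S) T) = \<phi>"
proof -
  let ?\<rho> = "\<lambda>T. \<Sum>S\<in>Pow M. \<phi> S * P (ket S) T"
  have "?\<rho> \<in> G" by (rule G_sum) (use P0_props in auto)
  moreover have "\<forall>\<chi>\<in>G. finner M \<chi> (\<lambda>T. \<phi> T - ?\<rho> T) = 0"
  proof
    fix \<chi> assume \<chi>: "\<chi> \<in> G"
    have "(\<lambda>T. \<phi> T - ?\<rho> T) = (\<lambda>T. \<Sum>S\<in>Pow M. \<phi> S * (ket S T - P (ket S) T))"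
    proof
      fix T
      have "(\<Sum>S\<in>Pow M. \<phi> S * ket S T) = (\<Sum>S\<in>Pow M. if S = T then \<phi> S else 0)"
        by (rule sum.cong) (auto simp: ket_def)
      also have "\<dots> = \<phi> T" using assms fockD[of \<phi> d L T] by (auto simp: G_iff)
      finally show "\<phi> T - ?\<rho> T = (\<Sum>S\<in>Pow M. \<phi> S * (ket S T - P (ket S) T))"
        by (simp add: right_diff_distrib sum_subtractf)
    qed
    then show "finner M \<chi> (\<lambda>T. \<phi> T - ?\<rho> T) = 0"
      by (simp add: finner_sum_right finner_scale_right P0_props(2)[OF \<chi>])
  qed
  ultimately have "P \<phi> = ?\<rho>" by (rule P0_eqI)
  moreover have "P \<phi> = \<phi>" by (rule P0_eqI) (use assms in \<open>auto simp: finner_def\<close>)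
  ultimately show ?thesis by simp
qed

text \<open>Each projected ket is expanded in the class vectors. A class vector lives on one
  particle number, so \<open>f\<close> depends on the class only; for a fixed class, the remaining
  sum over kets recombines to the coordinate of that vector along itself, which is 1.\<close>

lemma number_trace:
  fixes f :: "nat \<Rightarrow> complex"
  shows "(\<Sum>S\<in>Pow M. f (card S) * P (ket S) S)
    = (\<Sum>X\<in>Pow (lat_V d L). of_nat (spin_mult (lat_adj d L) X) * f (card X))"
proof -
  have "(\<Sum>S\<in>Pow M. f (card S) * P (ket S) S)
      = (\<Sum>S\<in>Pow M. \<Sum>i\<in>cls. f (card S) * (coord d L i (P (ket S)) * bv i S))"
  proof (rule sum.cong)
    fix S
    have "P (ket S) S = (\<Sum>i\<in>cls. coord d L i (P (ket S)) * bv i S)"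
      by (rule fun_cong[OF G_expand[OF P0_props(1)]])
    then show "f (card S) * P (ket S) S = (\<Sum>i\<in>cls. f (card S) * (coord d L i (P (ket S)) * bv i S))"
      by (simp only: sum_distrib_left)
  qed simp
  also have "\<dots> = (\<Sum>i\<in>cls. \<Sum>S\<in>Pow M. f (card S) * (coord d L i (P (ket S)) * bv i S))"
    by (rule sum.swap)
  also have "\<dots> = (\<Sum>i\<in>cls. f (card (fst i)))"
  proof (rule sum.cong)
    fix i assume i: "i \<in> cls"
    have "(\<Sum>S\<in>Pow M. f (card S) * (coord d L i (P (ket S)) * bv i S))
        = (\<Sum>S\<in>Pow M. f (card (fst i)) * (bv i S * coord d L i (P (ket S))))"
    proof (rule sum.cong)
      fix S assume "S \<in> Pow M"
      then show "f (card S) * (coord d L i (P (ket S)) * bv i S)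
          = f (card (fst i)) * (bv i S * coord d L i (P (ket S)))"
        using ground_vec_card[OF spin_classes_subset[OF i], of S lam]
        by (cases "card S = card (fst i)") auto
    qed simp
    also have "\<dots> = f (card (fst i)) * coord d L i (\<lambda>T. \<Sum>S\<in>Pow M. bv i S * P (ket S) T)"
      by (simp add: coord_sum sum_distrib_left)
    also have "(\<lambda>T. \<Sum>S\<in>Pow M. bv i S * P (ket S) T) = bv i"
      by (rule P0_ket_sum[OF bv_G[OF spin_classes_subset[OF i]]])
    finally show "(\<Sum>S\<in>Pow M. f (card S) * (coord d L i (P (ket S)) * bv i S)) = f (card (fst i))"
      by (simp add: coord_ground_vec[OF i])
  qed simp
  finally show ?thesis by (simp add: sum_spin_classes)
qed

section \<open>From the trace to the density\<close>

lemma N_e_apply: "T \<subseteq> M \<Longrightarrow> N_e d L \<phi> T = of_nat (card T) * \<phi> T"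
proof -
  assume T: "T \<subseteq> M"
  have "N_e d L \<phi> T = (\<Sum>m\<in>M. if m \<in> T then \<phi> T else 0)" by (simp add: N_e_def op_sum_def numop_apply)
  also have "\<dots> = (\<Sum>m\<in>M \<inter> T. \<phi> T)" by (rule sum.inter_restrict[symmetric]) simp
  also have "M \<inter> T = T" using T by auto
  finally show ?thesis by simp
qed

lemma gc_avg_number:
  fixes \<mu> :: real
  defines "w \<equiv> \<lambda>X. real (spin_mult (lat_adj d L) X) * exp \<mu> ^ card X"
  shows "gc_avg d L t lam U U' \<mu> (N_e d L)
    = of_real ((\<Sum>X\<in>Pow (lat_V d L). real (card X) * w X) / (\<Sum>X\<in>Pow (lat_V d L). w X))"
proof -
  have ex: "exp (\<mu> * real n) = exp \<mu> ^ n" for n by (simp add: exp_of_nat_mult mult.commute[of \<mu>])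
  have "ftrace M (expN \<mu> \<circ> P) = (\<Sum>S\<in>Pow M. of_real (exp \<mu> ^ card S) * P (ket S) S)"
    by (simp add: ftrace_def expN_def ex)
  also have "\<dots> = of_real (\<Sum>X\<in>Pow (lat_V d L). w X)"
    by (subst number_trace[of "\<lambda>n. of_real (exp \<mu> ^ n)"]) (simp add: w_def)
  finally have 1: "ftrace M (expN \<mu> \<circ> P) = of_real (\<Sum>X\<in>Pow (lat_V d L). w X)" .
  have "ftrace M (N_e d L \<circ> expN \<mu> \<circ> P) = (\<Sum>S\<in>Pow M. of_real (real (card S) * exp \<mu> ^ card S) * P (ket S) S)"
    unfolding ftrace_def by (rule sum.cong) (auto simp: N_e_apply expN_def ex)
  also have "\<dots> = of_real (\<Sum>X\<in>Pow (lat_V d L). real (card X) * w X)"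
    by (subst number_trace[of "\<lambda>n. of_real (real n * exp \<mu> ^ n)"]) (simp add: w_def mult_ac)
  finally show ?thesis unfolding gc_avg_def 1 by (simp only: of_real_divide)
qed

lemma number_density:
  fixes \<mu> :: real
  assumes L: "4 \<le> L"
  defines "w \<equiv> \<lambda>X. real (spin_mult (lat_adj d L) X) * exp \<mu> ^ card X"
  defines "r \<equiv> (\<Sum>X\<in>Pow (lat_V d L). real (card X) * w X) / (\<Sum>X\<in>Pow (lat_V d L). w X)"
  shows "r / real (L ^ d) \<le> inverse (1 + exp (-\<mu>) / 2)"
    and "inverse (3 ^ d) * inverse (1 + exp (-\<mu>) / 2) \<le> r / real (L ^ d)"
    and "2 \<le> d \<Longrightarrow> 1 - 3 ^ (d * (2 * d)) * exp 1 * exp (-\<mu>) \<le> r / real (L ^ d)"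
proof -
  let ?V = "lat_V d L" and ?E = "lat_adj d L"
  define z where "z = exp \<mu>"
  define Z where "Z = (\<Sum>X\<in>Pow ?V. w X)"
  define R where "R = (\<Sum>X\<in>Pow ?V. real (card X) * w X)"
  define N where "N = real (L ^ d)"
  have z: "0 < z" and N: "0 < N" using L by (auto simp: z_def N_def)
  have w: "w X = real (spin_mult ?E X) * z ^ card X" for X by (simp add: w_def z_def)
  have w0: "0 < w X" if "X \<subseteq> ?V" for X
    using spin_mult_pos[OF finite_lat_subset[OF that]] z by (simp add: w)
  have Z: "0 < Z" unfolding Z_def by (rule sum_pos) (use w0 in auto)
  have r: "r / real (L ^ d) = R / (Z * N)" by (simp add: r_def R_def Z_def N_def)
  have p: "inverse (1 + exp (-\<mu>) / 2) = 2 * z / (1 + 2 * z)"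
    using z by (simp add: exp_minus z_def field_simps)
  have "(1 + 2 * z) * R \<le> 2 * z * real (card ?V) * Z"
    unfolding R_def Z_def
  proof (rule mean_card_upper)
    fix x X assume x: "x \<in> ?V" "X \<subseteq> ?V" "x \<notin> X"
    have fin: "finite X" using finite_lat_subset[OF x(2)] .
    have "real (spin_mult ?E (insert x X)) \<le> 2 * real (spin_mult ?E X)"
      using spin_mult_insert_le[OF symp_lat_adj[of d L] fin x(3)] by linarith
    then have "real (spin_mult ?E (insert x X)) * z ^ card (insert x X) \<le> 2 * real (spin_mult ?E X) * z ^ card (insert x X)"
      using z by (intro mult_right_mono) auto
    then show "w (insert x X) \<le> 2 * z * w X" using fin x(3) by (simp add: w mult_ac)
  qed simp
  then have "(1 + 2 * z) * R \<le> 2 * z * N * Z" by (simp add: N_def)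
  then show "r / real (L ^ d) \<le> inverse (1 + exp (-\<mu>) / 2)"
    unfolding r p using z Z N by (simp add: field_simps)
  have "2 * z * real (card ?V) * Z \<le> (1 + 2 * z + 2 * z * real (2 * d)) * R"
    unfolding R_def Z_def
  proof (rule mean_card_lower[where nb = "\<lambda>x. {y \<in> ?V. ?E x y}"])
    fix x assume x: "x \<in> ?V"
    show "{y \<in> ?V. ?E x y} \<subseteq> ?V - {x}" using lat_adj_neq[OF x two_le_L] by auto
  next
    fix y assume "y \<in> ?V"
    then have "{x \<in> ?V. y \<in> {y \<in> ?V. ?E x y}} = {x \<in> ?V. ?E y x}" by (auto simp: lat_adj_commute[of d L y])
    then show "card {x \<in> ?V. y \<in> {y \<in> ?V. ?E x y}} \<le> 2 * d" using card_lat_nbrs[of d L y] by simp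
  next
    fix x X assume x: "x \<in> ?V" "X \<subseteq> ?V" "x \<notin> X" "X \<inter> {y \<in> ?V. ?E x y} = {}"
    have fin: "finite X" using finite_lat_subset[OF x(2)] .
    have "\<forall>y\<in>X. \<not> ?E x y \<and> \<not> ?E y x" using x lat_adj_commute[of d L x] by blast
    then have "2 * real (spin_mult ?E X) \<le> real (spin_mult ?E (insert x X))"
      using spin_mult_insert_isolated[OF fin x(3), of ?E] by linarith
    then have "2 * real (spin_mult ?E X) * z ^ card (insert x X) \<le> real (spin_mult ?E (insert x X)) * z ^ card (insert x X)"
      using z by (intro mult_right_mono) auto
    then show "2 * z * w X \<le> w (insert x X)" using fin x(3) by (simp add: w mult_ac)
  qed (use z w0 less_imp_le in auto)
  then have lower: "2 * z * N * Z \<le> (1 + 2 * z + 2 * z * real (2 * d)) * R" by (simp add: N_def)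
  have R: "0 \<le> R" unfolding R_def
    by (intro sum_nonneg mult_nonneg_nonneg less_imp_le[OF w0]) auto
  \<comment> \<open>The neighbour count gives the factor 1 / (1 + 2 d), which is at least
    \<open>inverse (3 ^ d)\<close>.\<close>
  have "2 * k + 1 \<le> 3 ^ k" for k :: nat by (induction k) auto
  then have "real (2 * d + 1) \<le> real (3 ^ d)" by (intro of_nat_mono)
  then have b: "2 * real d + 1 \<le> 3 ^ d" by simp
  have "1 + 2 * z + 2 * z * real (2 * d) \<le> (1 + 2 * z) * (2 * real d + 1)"
    using z by (simp add: algebra_simps)
  also have "\<dots> \<le> (1 + 2 * z) * 3 ^ d" using b z by (intro mult_left_mono) auto
  finally have "(1 + 2 * z + 2 * z * real (2 * d)) * R \<le> (1 + 2 * z) * 3 ^ d * R"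
    using R by (rule mult_right_mono)
  then have le: "2 * z * N * Z \<le> (1 + 2 * z) * 3 ^ d * R" using lower by linarith
  define q where "q = (1 + 2 * z) * 3 ^ d"
  have "0 < q" using z by (auto simp: q_def intro!: mult_pos_pos)
  moreover have "2 * z * N * Z \<le> q * R" using le by (simp add: q_def)
  ultimately have "2 * z / q \<le> R / (Z * N)" using Z N by (simp add: field_simps)
  moreover have "inverse (3 ^ d) * inverse (1 + exp (-\<mu>) / 2) = 2 * z / q"
    unfolding p by (simp add: q_def divide_inverse)
  ultimately show "inverse (3 ^ d) * inverse (1 + exp (-\<mu>) / 2) \<le> r / real (L ^ d)"
    unfolding r by simp
  assume d2: "2 \<le> d"
  let ?c = "3 ^ (d * (2 * d)) :: real"
  have "real (card ?V) * (1 - ?c * exp 1 / z) * (\<Sum>X\<in>Pow ?V. real (spin_mult ?E X) * z ^ card X)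
    \<le> (\<Sum>X\<in>Pow ?V. real (card X) * (real (spin_mult ?E X) * z ^ card X))"
  proof (rule mean_complement_upper)
    fix X assume X: "X \<subseteq> ?V"
    have "spin_mult ?E X \<le> (L ^ d + 1) * 3 ^ (d * (2 * d * card (?V - X)))"
      by (rule spin_mult_exp_bound[OF X d2])
    \<comment> \<open>The total up-spin count shows that the full lattice has at least
      \<open>L ^ d + 1\<close> classes; this makes the bound relative to the fully occupied term,
      with a constant free of \<open>L\<close>.\<close>
    also have "\<dots> \<le> spin_mult ?E ?V * 3 ^ (d * (2 * d * card (?V - X)))"
      using spin_mult_ge[OF symp_lat_adj[of d L] finite_lat_V] by (intro mult_right_mono) auto
    finally have "real (spin_mult ?E X) \<le> real (spin_mult ?E ?V * 3 ^ (d * (2 * d * card (?V - X))))"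
      by (rule of_nat_mono)
    then show "real (spin_mult ?E X) \<le> real (spin_mult ?E ?V) * ?c ^ card (?V - X)"
      by (simp add: power_mult[symmetric] mult_ac)
  qed (use z spin_mult_pos[OF finite_lat_V] in auto)
  then have "N * (1 - ?c * exp 1 / z) * Z \<le> R" by (simp add: N_def Z_def R_def w)
  then have "(1 - ?c * exp 1 / z) \<le> R / (Z * N)" using Z N by (simp add: field_simps)
  then show "1 - ?c * exp 1 * exp (-\<mu>) \<le> r / real (L ^ d)"
    unfolding r by (simp add: z_def exp_minus field_simps)
qed

end

theorem theorem2p4:
  shows "(\<forall>(d::nat) (L::nat) (t::real) (lam::real) (U::real) (U'::real) (\<mu>::real).
            1 \<le> d \<and> even L \<and> 4 \<le> L \<and> 0 < t \<and> 0 < lam \<and> 0 < U \<and> 0 < U' \<longrightarrow>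
            (\<exists>r::real. gc_avg d L t lam U U' \<mu> (N_e d L) = of_real r \<and>
               inverse (1 + exp (-\<mu>) / 2) \<ge> r / real (L ^ d) \<and>
               r / real (L ^ d) \<ge> inverse (3 ^ d) * inverse (1 + exp (-\<mu>) / 2)))
       \<and> (\<forall>d::nat. 2 \<le> d \<longrightarrow>
            (\<exists>\<mu>1 c1 :: real. 0 < \<mu>1 \<and> 0 < c1 \<and>
              (\<forall>(L::nat) (t::real) (lam::real) (U::real) (U'::real) (\<mu>::real).
                 even L \<and> 4 \<le> L \<and> 0 < t \<and> 0 < lam \<and> 0 < U \<and> 0 < U' \<and> \<mu>1 \<le> \<mu> \<longrightarrow>
                 (\<exists>r::real. gc_avg d L t lam U U' \<mu> (N_e d L) = of_real r \<and>
                    r / real (L ^ d) \<ge> 1 - c1 * exp (-\<mu>)))))"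
proof (intro conjI allI impI)
  fix d L :: nat and t lam U U' \<mu> :: real
  assume a: "1 \<le> d \<and> even L \<and> 4 \<le> L \<and> 0 < t \<and> 0 < lam \<and> 0 < U \<and> 0 < U'"
  then interpret decorated_model d L t lam U U' by unfold_locales auto
  show "\<exists>r::real. gc_avg d L t lam U U' \<mu> (N_e d L) = of_real r \<and>
               inverse (1 + exp (-\<mu>) / 2) \<ge> r / real (L ^ d) \<and>
               r / real (L ^ d) \<ge> inverse (3 ^ d) * inverse (1 + exp (-\<mu>) / 2)"
    using gc_avg_number number_density(1,2) a by blast
next
  fix d :: nat
  assume d: "2 \<le> d"
  show "\<exists>\<mu>1 c1 :: real. 0 < \<mu>1 \<and> 0 < c1 \<and>
              (\<forall>(L::nat) (t::real) (lam::real) (U::real) (U'::real) (\<mu>::real).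
                 even L \<and> 4 \<le> L \<and> 0 < t \<and> 0 < lam \<and> 0 < U \<and> 0 < U' \<and> \<mu>1 \<le> \<mu> \<longrightarrow>
                 (\<exists>r::real. gc_avg d L t lam U U' \<mu> (N_e d L) = of_real r \<and>
                    r / real (L ^ d) \<ge> 1 - c1 * exp (-\<mu>)))"
  \<comment> \<open>\<open>c1\<close> is the growth constant 3 ^ (2 d ^ 2) per empty site times the
    e of the exponential moment; \<open>\<mu>1\<close> is an arbitrary positive number.\<close>
  proof (rule exI[of _ 1], rule exI[of _ "3 ^ (d * (2 * d)) * exp 1"], intro conjI allI impI)
    fix L :: nat and t lam U U' \<mu> :: real
    assume a: "even L \<and> 4 \<le> L \<and> 0 < t \<and> 0 < lam \<and> 0 < U \<and> 0 < U' \<and> 1 \<le> \<mu>"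
    then interpret decorated_model d L t lam U U' by unfold_locales auto
    show "\<exists>r::real. gc_avg d L t lam U U' \<mu> (N_e d L) = of_real r \<and>
                    r / real (L ^ d) \<ge> 1 - 3 ^ (d * (2 * d)) * exp 1 * exp (-\<mu>)"
      using gc_avg_number number_density(3)[OF _ d] a by fastforce
  qed auto
qed

end
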